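(* Let $(M,F,g)$ be an $(\alpha,\varepsilon)$-metric manifold with $\alpha=+1$ and fundamental tensor $\phi(\cdot,\cdot)=g(F\cdot,\cdot)$, and let $\mathcal G_g$ be the generalized metric on $\mathbb TM=TM\oplus T^*M$ induced by $g$. Then, for $\lambda\in\{+1,-1\}$, the generalized almost product structure $$\mathcal F_{\lambda,F}=\begin{pmatrix}F&0\\0&\lambda F^*\end{pmatrix}$$ is compatible with $\mathcal G_g$. In particular, when $\varepsilon=+1$, $(\mathcal F_{\lambda,F},\mathcal G_g)$ is a generalized Riemannian or pseudo-Riemannian almost product structure (depending on whether $g$ is Riemannian or pseudo-Riemannian); and when $\varepsilon=-1$, $(\mathcal F_{\lambda,F},\mathcal G_g)$ is a generalized almost para-Hermitian structure. The fundamental tensor of $(\mathcal F_{\lambda,F},\mathcal G_g)$ is $$\Phi_{\mathcal F_{\lambda,F}}(X+\xi,Y+\eta)=\phi(X,Y)+\lambda\,\phi(\sharp_\phi\xi,\sharp_\phi\eta)$$ for all $X,Y\in\mathfrak X(M)$, $\xi,\eta\in\Lambda^1(M)$.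
   Context: An $(\alpha,\varepsilon)$-metric manifold $(M,F,g)$, $\alpha,\varepsilon\in\{+1,-1\}$, is a smooth manifold with a Riemannian or pseudo-Riemannian (i.e. nondegenerate, not positive definite) metric $g$ and an $\mathfrak F(M)$-linear $F\colon\mathfrak X(M)\to\mathfrak X(M)$ with $F^2=\alpha Id$ and $g(FX,FY)=\varepsilon g(X,Y)$ for all $X,Y$. $\mathfrak F(M)$, $\mathfrak X(M)$, $\Lambda^1(M)$ denote smooth functions, vector fields, 1-forms; sections of $\mathbb TM$ are written $X+\xi$. For a nondegenerate bilinear form $b$ on $M$: $(\flat_bX)(Y)=b(X,Y)$, $\sharp_b=\flat_b^{-1}$. $(F^*\xi)(X)=\xi(FX)$. Matrix notation: $\begin{pmatrix}H&\sigma\\ \tau&K\end{pmatrix}(X+\xi)=(HX+\sigma\xi)+(\tau X+K\xi)$. $\mathcal G_g(X+\xi,Y+\eta)=g(X,Y)+g(\sharp_g\xi,\sharp_g\eta)$. Compatible means: there is $\delta\in\{+1,-1\}$ with $\mathcal G(\mathcal Ku,\mathcal Kv)=\delta\,\mathcal G(u,v)$ for all sections $u,v$. For an $\mathfrak F(M)$-linear endomorphism $\mathcal F$ of $\Gamma(\mathbb TM)$ with $\mathcal F^2=Id$ (generalized almost product structure), $(\mathcal F,\mathcal G)$ is generalized Riemannian (resp. pseudo-Riemannian) almost product if $\delta=+1$ and $\mathcal G$ is Riemannian (resp. pseudo-Riemannian), and generalized almost para-Hermitian if $\delta=-1$. The fundamental tensor is $\Phi_{\mathcal F}(u,v)=\mathcal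 G(\mathcal Fu,v)$ (here with $\mathcal G=\mathcal G_g$). *)

theory Defs
  imports "HOL-Analysis.Analysis" "HOL-Library.Function_Algebras"
begin

text \<open>
  Sums of vector fields, of 1-forms and of sections of \<open>TM \<oplus> T*M\<close>, and the ring operations on
  functions \<open>M \<rightarrow> \<real>\<close>, are the pointwise and componentwise ones on function and product types.
\<close>

subsection \<open>Smooth manifolds\<close>

text \<open>Both notions are meant for open \<open>S\<close> and finite-dimensional domains.\<close>

primrec Ck_on :: "nat \<Rightarrow> 'a::real_normed_vector set \<Rightarrow> ('a \<Rightarrow> 'b::real_normed_vector) \<Rightarrow> bool" where
  "Ck_on 0 S f \<longleftrightarrow> continuous_on S f"
| "Ck_on (Suc k) S f \<longleftrightarrow> (\<forall>x\<in>S. f differentiable (at x)) \<and>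
     (\<forall>v. Ck_on k S (\<lambda>x. frechet_derivative f (at x) v))"

definition smooth_on :: "'a::real_normed_vector set \<Rightarrow> ('a \<Rightarrow> 'b::real_normed_vector) \<Rightarrow> bool" where
  "smooth_on S f \<longleftrightarrow> (\<forall>k. Ck_on k S f)"

type_synonym ('a, 'n) chart = "'a set \<times> ('a \<Rightarrow> real^'n)"

definition chart_inv :: "('a, 'n::finite) chart \<Rightarrow> real^'n \<Rightarrow> 'a" where
  "chart_inv c = inv_into (fst c) (snd c)"

definition transition :: "('a, 'n::finite) chart \<Rightarrow> ('a, 'n) chart \<Rightarrow> real^'n \<Rightarrow> real^'n" where
  "transition c d = snd d \<circ> chart_inv c"

text \<open>
  A smooth manifold is a Hausdorff, second countable space \<open>M\<close>, given as a type, with a smooth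
  atlas; the atlas need not be maximal.
\<close>

definition smooth_atlas ::
  "('a::{t2_space,second_countable_topology}, 'n::finite) chart set \<Rightarrow> bool" where
  "smooth_atlas A \<longleftrightarrow>
     (\<Union>c\<in>A. fst c) = UNIV \<and>
     (\<forall>c\<in>A. open (fst c) \<and> open (snd c ` fst c) \<and>
        homeomorphism (fst c) (snd c ` fst c) (snd c) (chart_inv c)) \<and>
     (\<forall>c\<in>A. \<forall>d\<in>A. smooth_on (snd c ` (fst c \<inter> fst d)) (transition c d))"

definition smooth_functions :: "('a, 'n::finite) chart set \<Rightarrow> ('a \<Rightarrow> real) set" where
  "smooth_functions A = {f. \<forall>c\<in>A. smooth_on (snd c ` fst c) (f \<circ> chart_inv c)}"

text \<open>
  A tangent vector at \<open>p\<close> is the family of its coordinate vectors in all charts around \<open>p\<close>, related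
  by the derivatives of the transition maps. Entries at other charts are set to \<open>0\<close>, so that
  equality of functions is equality of tangent vectors.
\<close>

type_synonym ('a, 'n) tvec = "('a, 'n) chart \<Rightarrow> real^'n"
type_synonym ('a, 'n) vfield = "'a \<Rightarrow> ('a, 'n) tvec"

definition tangent_space :: "('a, 'n::finite) chart set \<Rightarrow> 'a \<Rightarrow> ('a, 'n) tvec set" where
  "tangent_space A p = {v.
     (\<forall>c. \<not> (c \<in> A \<and> p \<in> fst c) \<longrightarrow> v c = 0) \<and>
     (\<forall>c\<in>A. \<forall>d\<in>A. p \<in> fst c \<inter> fst d \<longrightarrow>
        v d = frechet_derivative (transition c d) (at (snd c p)) (v c))}"

definition vector_fields :: "('a, 'n::finite) chart set \<Rightarrow> ('a, 'n) vfield set" where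
  "vector_fields A = {X. (\<forall>p. X p \<in> tangent_space A p) \<and>
     (\<forall>c\<in>A. smooth_on (snd c ` fst c) (\<lambda>x. X (chart_inv c x) c))}"

definition vf_scale :: "('a \<Rightarrow> real) \<Rightarrow> ('a, 'n::finite) vfield \<Rightarrow> ('a, 'n) vfield" where
  "vf_scale f X = (\<lambda>p c. f p *\<^sub>R X p c)"

subsection \<open>Linear maps and metrics over the ring of smooth functions\<close>

definition fun_linear ::
  "('a \<Rightarrow> real) set \<Rightarrow> (('a \<Rightarrow> real) \<Rightarrow> 'u::plus \<Rightarrow> 'u) \<Rightarrow> 'u set \<Rightarrow>
   (('a \<Rightarrow> real) \<Rightarrow> 'v::plus \<Rightarrow> 'v) \<Rightarrow> 'v set \<Rightarrow> ('u \<Rightarrow> 'v) \<Rightarrow> bool" where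
  "fun_linear R s U t V T \<longleftrightarrow>
     (\<forall>x\<in>U. T x \<in> V) \<and>
     (\<forall>x\<in>U. \<forall>y\<in>U. T (x + y) = T x + T y) \<and>
     (\<forall>f\<in>R. \<forall>x\<in>U. T (s f x) = t f (T x))"

definition symmetric_bilinear ::
  "('a \<Rightarrow> real) set \<Rightarrow> (('a \<Rightarrow> real) \<Rightarrow> 'u::plus \<Rightarrow> 'u) \<Rightarrow> 'u set \<Rightarrow>
   ('u \<Rightarrow> 'u \<Rightarrow> 'a \<Rightarrow> real) \<Rightarrow> bool" where
  "symmetric_bilinear R s U b \<longleftrightarrow>
     (\<forall>u\<in>U. fun_linear R s U (*) R (b u)) \<and>
     (\<forall>u\<in>U. fun_linear R s U (*) R (\<lambda>v. b v u)) \<and>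
     (\<forall>u\<in>U. \<forall>v\<in>U. b u v = b v u)"

text \<open>
  In the next two definitions \<open>van u p\<close> says that the value of the section \<open>u\<close> at \<open>p\<close> is zero;
  both are conditions on the fibre at each point \<open>p\<close>.
\<close>

definition nondegenerate ::
  "'u set \<Rightarrow> ('u \<Rightarrow> 'a \<Rightarrow> bool) \<Rightarrow> ('u \<Rightarrow> 'u \<Rightarrow> 'a \<Rightarrow> real) \<Rightarrow> bool" where
  "nondegenerate U van b \<longleftrightarrow> (\<forall>p. \<forall>u\<in>U. (\<forall>v\<in>U. b u v p = 0) \<longrightarrow> van u p)"

definition positive_definite ::
  "'u set \<Rightarrow> ('u \<Rightarrow> 'a \<Rightarrow> bool) \<Rightarrow> ('u \<Rightarrow> 'u \<Rightarrow> 'a \<Rightarrow> real) \<Rightarrow> bool" where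
  "positive_definite U van b \<longleftrightarrow> (\<forall>p. \<forall>u\<in>U. \<not> van u p \<longrightarrow> b u u p > 0)"

subsection \<open>Metrics, 1-forms and musical isomorphisms on \<open>M\<close>\<close>

definition vf_vanishes :: "('a, 'n::finite) vfield \<Rightarrow> 'a \<Rightarrow> bool" where
  "vf_vanishes X p \<longleftrightarrow> X p = 0"

type_synonym ('a, 'n) vf_form = "('a, 'n) vfield \<Rightarrow> ('a, 'n) vfield \<Rightarrow> 'a \<Rightarrow> real"

definition riemannian_metric :: "('a, 'n::finite) chart set \<Rightarrow> ('a, 'n) vf_form \<Rightarrow> bool" where
  "riemannian_metric A g \<longleftrightarrow>
     symmetric_bilinear (smooth_functions A) vf_scale (vector_fields A) g \<and>
     positive_definite (vector_fields A) vf_vanishes g"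

definition pseudo_riemannian_metric :: "('a, 'n::finite) chart set \<Rightarrow> ('a, 'n) vf_form \<Rightarrow> bool" where
  "pseudo_riemannian_metric A g \<longleftrightarrow>
     symmetric_bilinear (smooth_functions A) vf_scale (vector_fields A) g \<and>
     nondegenerate (vector_fields A) vf_vanishes g \<and>
     \<not> positive_definite (vector_fields A) vf_vanishes g"

definition metric_manifold ::
  "real \<Rightarrow> real \<Rightarrow> ('a::{t2_space,second_countable_topology}, 'n::finite) chart set \<Rightarrow>
   (('a, 'n) vfield \<Rightarrow> ('a, 'n) vfield) \<Rightarrow> ('a, 'n) vf_form \<Rightarrow> bool" where
  "metric_manifold \<alpha> \<epsilon> A F g \<longleftrightarrow>
     \<alpha> \<in> {1, -1} \<and> \<epsilon> \<in> {1, -1} \<and> smooth_atlas A \<and>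
     (riemannian_metric A g \<or> pseudo_riemannian_metric A g) \<and>
     fun_linear (smooth_functions A) vf_scale (vector_fields A) vf_scale (vector_fields A) F \<and>
     (\<forall>X\<in>vector_fields A. F (F X) = vf_scale (\<lambda>_. \<alpha>) X) \<and>
     (\<forall>X\<in>vector_fields A. \<forall>Y\<in>vector_fields A. \<forall>p. g (F X) (F Y) p = \<epsilon> * g X Y p)"

text \<open>
  1-forms are the function-linear maps from vector fields to smooth functions, extended by \<open>0\<close>
  to all of the type.
\<close>

type_synonym ('a, 'n) oneform = "('a, 'n) vfield \<Rightarrow> 'a \<Rightarrow> real"

definition one_forms :: "('a, 'n::finite) chart set \<Rightarrow> ('a, 'n) oneform set" where
  "one_forms A = {\<xi>.
     fun_linear (smooth_functions A) vf_scale (vector_fields A) (*) (smooth_functions A) \<xi> \<and>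
     (\<forall>X. X \<notin> vector_fields A \<longrightarrow> \<xi> X = 0)}"

definition form_scale :: "('a \<Rightarrow> real) \<Rightarrow> ('a, 'n::finite) oneform \<Rightarrow> ('a, 'n) oneform" where
  "form_scale f \<xi> = (\<lambda>X. f * \<xi> X)"

definition flat :: "('a, 'n::finite) chart set \<Rightarrow> ('a, 'n) vf_form \<Rightarrow>
    ('a, 'n) vfield \<Rightarrow> ('a, 'n) oneform" where
  "flat A b X = (\<lambda>Y. if Y \<in> vector_fields A then b X Y else 0)"

definition sharp :: "('a, 'n::finite) chart set \<Rightarrow> ('a, 'n) vf_form \<Rightarrow>
    ('a, 'n) oneform \<Rightarrow> ('a, 'n) vfield" where
  "sharp A b = inv_into (vector_fields A) (flat A b)"

definition dual_map :: "('a, 'n::finite) chart set \<Rightarrow> (('a, 'n) vfield \<Rightarrow> ('a, 'n) vfield) \<Rightarrow>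
    ('a, 'n) oneform \<Rightarrow> ('a, 'n) oneform" where
  "dual_map A F \<xi> = (\<lambda>X. if X \<in> vector_fields A then \<xi> (F X) else 0)"

subsection \<open>The generalized tangent bundle\<close>

type_synonym ('a, 'n) gsec = "('a, 'n) vfield \<times> ('a, 'n) oneform"

definition gsections :: "('a, 'n::finite) chart set \<Rightarrow> ('a, 'n) gsec set" where
  "gsections A = vector_fields A \<times> one_forms A"

definition gscale :: "('a \<Rightarrow> real) \<Rightarrow> ('a, 'n::finite) gsec \<Rightarrow> ('a, 'n) gsec" where
  "gscale f u = (vf_scale f (fst u), form_scale f (snd u))"

definition gvanishes :: "('a, 'n::finite) chart set \<Rightarrow> ('a, 'n) gsec \<Rightarrow> 'a \<Rightarrow> bool" where
  "gvanishes A u p \<longleftrightarrow> vf_vanishes (fst u) p \<and> (\<forall>Y\<in>vector_fields A. snd u Y p = 0)"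

type_synonym ('a, 'n) gform = "('a, 'n) gsec \<Rightarrow> ('a, 'n) gsec \<Rightarrow> 'a \<Rightarrow> real"

definition gen_riemannian_metric :: "('a, 'n::finite) chart set \<Rightarrow> ('a, 'n) gform \<Rightarrow> bool" where
  "gen_riemannian_metric A G \<longleftrightarrow>
     symmetric_bilinear (smooth_functions A) gscale (gsections A) G \<and>
     positive_definite (gsections A) (gvanishes A) G"

definition gen_pseudo_riemannian_metric ::
  "('a, 'n::finite) chart set \<Rightarrow> ('a, 'n) gform \<Rightarrow> bool" where
  "gen_pseudo_riemannian_metric A G \<longleftrightarrow>
     symmetric_bilinear (smooth_functions A) gscale (gsections A) G \<and>
     nondegenerate (gsections A) (gvanishes A) G \<and>
     \<not> positive_definite (gsections A) (gvanishes A) G"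

definition induced_metric ::
  "('a, 'n::finite) chart set \<Rightarrow> ('a, 'n) vf_form \<Rightarrow> ('a, 'n) gform" where
  "induced_metric A g u v =
     g (fst u) (fst v) + g (sharp A g (snd u)) (sharp A g (snd v))"

definition block_matrix ::
  "(('a, 'n::finite) vfield \<Rightarrow> ('a, 'n) vfield) \<Rightarrow> (('a, 'n) oneform \<Rightarrow> ('a, 'n) vfield) \<Rightarrow>
   (('a, 'n) vfield \<Rightarrow> ('a, 'n) oneform) \<Rightarrow> (('a, 'n) oneform \<Rightarrow> ('a, 'n) oneform) \<Rightarrow>
   ('a, 'n) gsec \<Rightarrow> ('a, 'n) gsec" where
  "block_matrix H \<sigma> \<tau> K u = (H (fst u) + \<sigma> (snd u), \<tau> (fst u) + K (snd u))"

definition diag_structure ::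
  "('a, 'n::finite) chart set \<Rightarrow> real \<Rightarrow> (('a, 'n) vfield \<Rightarrow> ('a, 'n) vfield) \<Rightarrow>
   ('a, 'n) gsec \<Rightarrow> ('a, 'n) gsec" where
  "diag_structure A l F =
     block_matrix F (\<lambda>_. 0) (\<lambda>_. 0) (\<lambda>\<xi>. form_scale (\<lambda>_. l) (dual_map A F \<xi>))"

definition gen_almost_product ::
  "('a, 'n::finite) chart set \<Rightarrow> (('a, 'n) gsec \<Rightarrow> ('a, 'n) gsec) \<Rightarrow> bool" where
  "gen_almost_product A K \<longleftrightarrow>
     fun_linear (smooth_functions A) gscale (gsections A) gscale (gsections A) K \<and>
     (\<forall>u\<in>gsections A. K (K u) = u)"

definition compatible_with_sign ::
  "('a, 'n::finite) chart set \<Rightarrow> real \<Rightarrow> (('a, 'n) gsec \<Rightarrow> ('a, 'n) gsec) \<Rightarrow>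
   ('a, 'n) gform \<Rightarrow> bool" where
  "compatible_with_sign A \<delta> K G \<longleftrightarrow>
     (\<forall>u\<in>gsections A. \<forall>v\<in>gsections A. \<forall>p. G (K u) (K v) p = \<delta> * G u v p)"

definition compatible ::
  "('a, 'n::finite) chart set \<Rightarrow> (('a, 'n) gsec \<Rightarrow> ('a, 'n) gsec) \<Rightarrow> ('a, 'n) gform \<Rightarrow> bool" where
  "compatible A K G \<longleftrightarrow> (\<exists>\<delta>\<in>{1, -1}. compatible_with_sign A \<delta> K G)"

definition gen_riemannian_almost_product ::
  "('a, 'n::finite) chart set \<Rightarrow> (('a, 'n) gsec \<Rightarrow> ('a, 'n) gsec) \<Rightarrow> ('a, 'n) gform \<Rightarrow> bool" where
  "gen_riemannian_almost_product A K G \<longleftrightarrow>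
     gen_almost_product A K \<and> gen_riemannian_metric A G \<and> compatible_with_sign A 1 K G"

definition gen_pseudo_riemannian_almost_product ::
  "('a, 'n::finite) chart set \<Rightarrow> (('a, 'n) gsec \<Rightarrow> ('a, 'n) gsec) \<Rightarrow> ('a, 'n) gform \<Rightarrow> bool" where
  "gen_pseudo_riemannian_almost_product A K G \<longleftrightarrow>
     gen_almost_product A K \<and> gen_pseudo_riemannian_metric A G \<and> compatible_with_sign A 1 K G"

definition gen_almost_para_hermitian ::
  "('a, 'n::finite) chart set \<Rightarrow> (('a, 'n) gsec \<Rightarrow> ('a, 'n) gsec) \<Rightarrow> ('a, 'n) gform \<Rightarrow> bool" where
  "gen_almost_para_hermitian A K G \<longleftrightarrow>
     gen_almost_product A K \<and>
     (gen_riemannian_metric A G \<or> gen_pseudo_riemannian_metric A G) \<and>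
     compatible_with_sign A (-1) K G"

text \<open>Used both for \<open>(g, F)\<close> on \<open>M\<close> and for generalized metrics and structures.\<close>

definition fundamental_tensor ::
  "('u \<Rightarrow> 'u \<Rightarrow> 'a \<Rightarrow> real) \<Rightarrow> ('u \<Rightarrow> 'u) \<Rightarrow> 'u \<Rightarrow> 'u \<Rightarrow> 'a \<Rightarrow> real" where
  "fundamental_tensor b K u v = b (K u) v"

end

theory Submission
  imports Defs "HOL-Real_Asymp.Real_Asymp"
begin

text \<open>
  The point with analytic content is that \<open>flat A g\<close> is a bijection from vector fields onto
  function-linear 1-forms. Multiplying a coordinate frame by a bump function gives global vector
  fields \<open>E i\<close> and, for every function-linear \<open>\<omega>\<close>, the identity
  \<open>h\<^sup>2 \<omega>(Y) = \<Sum>i. (h Y\<^sup>i) \<omega>(E i)\<close>, so \<open>\<omega>(Y)\<close> at \<open>p\<close> depends only on the value of \<open>Y\<close> at \<open>p\<close>.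
  Nondegeneracy makes the Gram matrix of the frame invertible, and solving the Gram system
  yields \<open>sharp A g \<xi>\<close>. The rest is algebra: \<open>F\<close> is \<open>g\<close>-adjoint to \<open>\<epsilon> F\<close>, hence
  \<open>sharp A g (dual_map A F \<xi>) = \<epsilon> F (sharp A g \<xi>)\<close> and \<open>sharp A \<phi> \<xi> = F (sharp A g \<xi>)\<close>.
\<close>

subsection \<open>Calculus of smooth maps\<close>

text \<open>Tensors here are function-linear maps on global sections, so values at a point are
  reached only through locality, and \<open>sharp\<close> is an \<open>inv_into\<close>, which says
  nothing about a form until that form is known to lie in the image of \<open>flat\<close>. This is
  why surjectivity precedes every formula for \<open>sharp\<close>. The coordinate fields needed for
  it live only on a chart domain, hence the cut-off. It enters squared because the components of a
  field are as local as the coordinate fields: each of the two needs its own factor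
  \<open>h\<close>. The sign \<alpha> = 1 acts through F F = id: \<open>flat\<close> of \<phi> is
  \<open>flat\<close> of g after F, so its inverse is F after \<open>sharp\<close> of g. Read
  through \<open>sharp\<close>, the form block of the lifted structure is l \<epsilon> F. In the
  compatibility condition this sign is squared and disappears; in the fundamental tensor l survives,
  while \<epsilon> is absorbed by passing from \<open>sharp A g\<close> to
  \<open>sharp A \<phi>\<close>.\<close>

lemma Ck_on_cong:
  assumes "open S" "\<And>x. x \<in> S \<Longrightarrow> f x = g x" "Ck_on k S f"
  shows "Ck_on k S g"
  using assms(2,3)
proof (induction k arbitrary: f g)
  case 0
  then show ?case by (simp cong: continuous_on_cong)
next
  case (Suc k)
  have D: "(g has_derivative frechet_derivative f (at x)) (at x)" if "x \<in> S" for x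
  proof (rule has_derivative_transform_within_open[OF _ assms(1) that])
    show "(f has_derivative frechet_derivative f (at x)) (at x)"
      using Suc.prems(2) that by (simp add: frechet_derivative_works)
  qed (use Suc.prems(1) in simp)
  have "Ck_on k S (\<lambda>x. frechet_derivative g (at x) v)" for v
  proof (rule Suc.IH)
    show "Ck_on k S (\<lambda>x. frechet_derivative f (at x) v)"
      using Suc.prems(2) by simp
    show "frechet_derivative f (at x) v = frechet_derivative g (at x) v" if "x \<in> S" for x
      using frechet_derivative_at[OF D[OF that]] by simp
  qed
  then show ?case using D by (auto simp: differentiable_def)
qed

text \<open>\<open>Ck_on\<close> is phrased with the choice operator
  \<open>frechet_derivative\<close>; uniqueness of derivatives lets an explicit formula
  \<open>D\<close> stand in for it. The sum, product, chain and reciprocal rules all go through this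
  form.\<close>

lemma Ck_on_SucI:
  assumes "open S" "\<And>x. x \<in> S \<Longrightarrow> (f has_derivative D x) (at x)"
    and "\<And>v. Ck_on k S (\<lambda>x. D x v)"
  shows "Ck_on (Suc k) S f"
proof -
  have "D x = frechet_derivative f (at x)" if "x \<in> S" for x
    using frechet_derivative_at assms(2) that by blast
  then have "Ck_on k S (\<lambda>x. frechet_derivative f (at x) v)" for v
    by (intro Ck_on_cong[OF assms(1) _ assms(3)[of v]]) simp
  then show ?thesis
    using assms(2) by (auto simp: differentiable_def)
qed

lemma Ck_on_SucD:
  assumes "Ck_on (Suc k) S f"
  shows "x \<in> S \<Longrightarrow> (f has_derivative frechet_derivative f (at x)) (at x)"
    and "Ck_on k S (\<lambda>x. frechet_derivative f (at x) v)"
  using assms by (auto simp: frechet_derivative_works)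

lemma Ck_on_Suc_imp: "Ck_on (Suc k) S f \<Longrightarrow> Ck_on k S f"
proof (induction k arbitrary: f)
  case 0
  then show ?case
    by (auto intro!: continuous_at_imp_continuous_on differentiable_imp_continuous_within)
next
  case (Suc k)
  then show ?case by (metis Ck_on.simps(2))
qed

lemma Ck_on_subset: "Ck_on k S f \<Longrightarrow> T \<subseteq> S \<Longrightarrow> Ck_on k T f"
  by (induction k arbitrary: f) (auto intro: continuous_on_subset)

lemma Ck_on_local:
  assumes "\<And>x. x \<in> S \<Longrightarrow> \<exists>N. open N \<and> x \<in> N \<and> Ck_on k N f"
  shows "Ck_on k S f"
  using assms
proof (induction k arbitrary: f)
  case 0
  then show ?case
    by (auto intro!: continuous_at_imp_continuous_on) (metis continuous_on_eq_continuous_at)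
next
  case (Suc k)
  have "f differentiable at x" if "x \<in> S" for x
    using Suc.prems[OF that] by auto
  moreover have "Ck_on k S (\<lambda>x. frechet_derivative f (at x) v)" for v
  proof (rule Suc.IH)
    fix x assume "x \<in> S"
    then obtain N where "open N" "x \<in> N" "Ck_on (Suc k) N f"
      using Suc.prems by blast
    then show "\<exists>N. open N \<and> x \<in> N \<and> Ck_on k N (\<lambda>x. frechet_derivative f (at x) v)"
      by auto
  qed
  ultimately show ?case by simp
qed

lemma Ck_on_const: "Ck_on k S (\<lambda>x. c)"
  by (induction k arbitrary: c) auto

lemma Ck_on_bounded_linear:
  assumes "open S" "bounded_linear L"
  shows "Ck_on k S L"
proof (cases k)
  case 0
  then show ?thesis using assms(2) by (simp add: linear_continuous_on)
next
  case (Suc m)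
  show ?thesis unfolding Suc
    by (rule Ck_on_SucI[where D = "\<lambda>_. L"])
      (use assms in \<open>auto intro: Ck_on_const bounded_linear_imp_has_derivative\<close>)
qed

lemma Ck_on_add:
  assumes "open S" "Ck_on k S f" "Ck_on k S g"
  shows "Ck_on k S (\<lambda>x. f x + g x)"
  using assms(2,3)
proof (induction k arbitrary: f g)
  case 0
  then show ?case by (auto intro: continuous_intros)
next
  case (Suc k)
  note D = Ck_on_SucD[OF Suc.prems(1)] Ck_on_SucD[OF Suc.prems(2)]
  show ?case
    by (rule Ck_on_SucI[OF assms(1) has_derivative_add[OF D(1) D(3)] Suc.IH[OF D(2) D(4)]])
qed

text \<open>By the Leibniz rule the derivative is a sum of two values of \<open>prod\<close>, each
  pairing an original factor with a derivative, so the induction also needs the original factors at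
  the lower order. One proof serves scalar, inner and real products.\<close>

lemma (in bounded_bilinear) Ck_on_bilinear:
  assumes "open S" "Ck_on k S f" "Ck_on k S g"
  shows "Ck_on k S (\<lambda>x. prod (f x) (g x))"
  using assms(2,3)
proof (induction k arbitrary: f g)
  case 0
  then show ?case by (auto intro: continuous_on)
next
  case (Suc k)
  note D = Ck_on_SucD[OF Suc.prems(1)] Ck_on_SucD[OF Suc.prems(2)]
  show ?case
    by (rule Ck_on_SucI[OF assms(1) FDERIV[OF D(1) D(3)]], assumption, assumption)
      (intro Ck_on_add assms(1) Suc.IH D(2,4) Suc.prems[THEN Ck_on_Suc_imp])+
qed

lemma Ck_on_sum:
  assumes "open S" "\<And>i. i \<in> I \<Longrightarrow> Ck_on k S (f i)"
  shows "Ck_on k S (\<lambda>x. \<Sum>i\<in>I. f i x)"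
  using assms(2)
  by (induction I rule: infinite_finite_induct) (auto intro!: Ck_on_const Ck_on_add assms(1))

lemma Ck_on_inner_const:
  assumes "open S" "Ck_on k S f"
  shows "Ck_on k S (\<lambda>x. f x \<bullet> b)"
  by (rule bounded_bilinear.Ck_on_bilinear[OF bounded_bilinear_inner assms Ck_on_const])

lemma linear_eq_sum_Basis:
  fixes f :: "'a::euclidean_space \<Rightarrow> 'b::real_vector"
  assumes "linear f"
  shows "f w = (\<Sum>b\<in>Basis. (w \<bullet> b) *\<^sub>R f b)"
  using linear_sum[OF assms, of "\<lambda>b. (w \<bullet> b) *\<^sub>R b" Basis]
  by (simp add: euclidean_representation linear_cmul[OF assms])

text \<open>The chain rule evaluates the derivative of \<open>f\<close> in a direction that varies
  with x, whereas \<open>Ck_on\<close> controls derivatives in fixed directions only. Expanding the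
  direction over \<open>Basis\<close> leaves smooth coefficients times fixed-direction derivatives
  of \<open>f\<close> composed with \<open>T\<close>, to which the induction hypothesis
  applies.\<close>

lemma Ck_on_compose:
  fixes f :: "'b::euclidean_space \<Rightarrow> 'c::real_normed_vector"
  assumes "open S" "open U" "Ck_on k U f" "Ck_on k S T" "\<And>x. x \<in> S \<Longrightarrow> T x \<in> U"
  shows "Ck_on k S (\<lambda>x. f (T x))"
  using assms(3,4)
proof (induction k arbitrary: f)
  case 0
  then show ?case using assms(5)
    by (auto intro: continuous_on_compose2)
next
  case (Suc k)
  note D = Ck_on_SucD[OF Suc.prems(1)] Ck_on_SucD[OF Suc.prems(2)]
  let ?D = "\<lambda>x v. \<Sum>b\<in>Basis. (frechet_derivative T (at x) v \<bullet> b) *\<^sub>R frechet_derivative f (at (T x)) b"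
  show ?case
  proof (rule Ck_on_SucI[OF assms(1), where D = ?D])
    fix x assume "x \<in> S"
    have *: "((\<lambda>x. f (T x)) has_derivative
        (\<lambda>v. frechet_derivative f (at (T x)) (frechet_derivative T (at x) v))) (at x)"
      by (rule has_derivative_compose[OF D(3)[OF \<open>x \<in> S\<close>] D(1)[OF assms(5)[OF \<open>x \<in> S\<close>]]])
    have lin: "frechet_derivative f (at (T x)) w =
        (\<Sum>b\<in>Basis. (w \<bullet> b) *\<^sub>R frechet_derivative f (at (T x)) b)" for w
      using D(1)[OF assms(5)[OF \<open>x \<in> S\<close>]] has_derivative_linear linear_eq_sum_Basis by blast
    show "((\<lambda>x. f (T x)) has_derivative ?D x) (at x)"
      by (rule has_derivative_eq_rhs[OF * ext[OF lin]])
  next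
    fix v
    show "Ck_on k S (\<lambda>x. ?D x v)"
      by (intro Ck_on_sum assms(1) bounded_bilinear.Ck_on_bilinear[OF bounded_bilinear_scaleR]
          Ck_on_inner_const D(4) Suc.IH D(2) Ck_on_Suc_imp[OF Suc.prems(2)])
  qed
qed

lemma Ck_on_inverse:
  fixes f :: "'a::real_normed_vector \<Rightarrow> real"
  assumes "open S" "Ck_on k S f" "\<And>x. x \<in> S \<Longrightarrow> f x \<noteq> 0"
  shows "Ck_on k S (\<lambda>x. inverse (f x))"
  using assms(2)
proof (induction k)
  case 0
  then show ?case using assms(3) by (auto intro: continuous_intros)
next
  case (Suc k)
  note D = Ck_on_SucD[OF Suc.prems]
  note mult = bounded_bilinear.Ck_on_bilinear[OF bounded_bilinear_mult assms(1)]
  show ?case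
  proof (rule Ck_on_SucI[OF assms(1)])
    show "((\<lambda>x. inverse (f x)) has_derivative
        (\<lambda>v. -1 * (inverse (f x) * frechet_derivative f (at x) v * inverse (f x)))) (at x)"
      if "x \<in> S" for x
      using Deriv.has_derivative_inverse[OF assms(3)[OF that] D(1)[OF that]] by simp
    show "Ck_on k S (\<lambda>x. -1 * (inverse (f x) * frechet_derivative f (at x) v * inverse (f x)))" for v
      by (intro mult Ck_on_const D(2) Suc.IH Ck_on_Suc_imp[OF Suc.prems])
  qed
qed

lemma smooth_on_cong:
  "open S \<Longrightarrow> (\<And>x. x \<in> S \<Longrightarrow> f x = g x) \<Longrightarrow> smooth_on S f \<Longrightarrow> smooth_on S g"
  unfolding smooth_on_def using Ck_on_cong by blast

lemma smooth_on_subset: "smooth_on S f \<Longrightarrow> T \<subseteq> S \<Longrightarrow> smooth_on T f"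
  unfolding smooth_on_def using Ck_on_subset by blast

lemma smooth_on_local:
  "(\<And>x. x \<in> S \<Longrightarrow> \<exists>N. open N \<and> x \<in> N \<and> smooth_on N f) \<Longrightarrow> smooth_on S f"
  unfolding smooth_on_def by (intro allI Ck_on_local) blast

lemma smooth_on_const: "smooth_on S (\<lambda>x. c)"
  by (simp add: smooth_on_def Ck_on_const)

lemma smooth_on_bounded_linear: "open S \<Longrightarrow> bounded_linear L \<Longrightarrow> smooth_on S L"
  by (simp add: smooth_on_def Ck_on_bounded_linear)

lemma smooth_on_add:
  "open S \<Longrightarrow> smooth_on S f \<Longrightarrow> smooth_on S g \<Longrightarrow> smooth_on S (\<lambda>x. f x + g x)"
  by (simp add: smooth_on_def Ck_on_add)

lemma smooth_on_sum:
  "open S \<Longrightarrow> (\<And>i. i \<in> I \<Longrightarrow> smooth_on S (f i)) \<Longrightarrow> smooth_on S (\<lambda>x. \<Sum>i\<in>I. f i x)"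
  by (simp add: smooth_on_def Ck_on_sum)

lemma smooth_on_scaleR:
  "open S \<Longrightarrow> smooth_on S f \<Longrightarrow> smooth_on S g \<Longrightarrow> smooth_on S (\<lambda>x. f x *\<^sub>R g x)"
  by (simp add: smooth_on_def bounded_bilinear.Ck_on_bilinear[OF bounded_bilinear_scaleR])

lemma smooth_on_mult:
  fixes f g :: "'a::real_normed_vector \<Rightarrow> real"
  shows "open S \<Longrightarrow> smooth_on S f \<Longrightarrow> smooth_on S g \<Longrightarrow> smooth_on S (\<lambda>x. f x * g x)"
  using smooth_on_scaleR[of S f g] by simp

lemma smooth_on_inner:
  "open S \<Longrightarrow> smooth_on S f \<Longrightarrow> smooth_on S g \<Longrightarrow> smooth_on S (\<lambda>x. f x \<bullet> g x)"
  by (simp add: smooth_on_def bounded_bilinear.Ck_on_bilinear[OF bounded_bilinear_inner])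

lemma smooth_on_prod:
  fixes f :: "'i \<Rightarrow> 'a::real_normed_vector \<Rightarrow> real"
  assumes "open S" "\<And>i. i \<in> I \<Longrightarrow> smooth_on S (f i)"
  shows "smooth_on S (\<lambda>x. \<Prod>i\<in>I. f i x)"
  using assms(2)
  by (induction I rule: infinite_finite_induct)
    (auto intro!: smooth_on_const smooth_on_mult assms(1))

lemma smooth_on_divide:
  fixes f g :: "'a::real_normed_vector \<Rightarrow> real"
  assumes "open S" "smooth_on S f" "smooth_on S g" "\<And>x. x \<in> S \<Longrightarrow> g x \<noteq> 0"
  shows "smooth_on S (\<lambda>x. f x / g x)"
  unfolding divide_inverse
  by (intro smooth_on_mult assms) (use assms in \<open>auto simp: smooth_on_def intro: Ck_on_inverse\<close>)

lemma smooth_on_compose: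
  fixes f :: "'b::euclidean_space \<Rightarrow> 'c::real_normed_vector"
  assumes "open S" "open U" "smooth_on U f" "smooth_on S T" "\<And>x. x \<in> S \<Longrightarrow> T x \<in> U"
  shows "smooth_on S (\<lambda>x. f (T x))"
  using assms Ck_on_compose[of S U _ f T] by (simp add: smooth_on_def)

lemma smooth_on_frechet_derivative:
  assumes "smooth_on S f"
  shows "smooth_on S (\<lambda>x. frechet_derivative f (at x) v)"
  unfolding smooth_on_def
proof
  fix k
  have "Ck_on (Suc k) S f" using assms by (simp add: smooth_on_def)
  then show "Ck_on k S (\<lambda>x. frechet_derivative f (at x) v)" by simp
qed

lemma smooth_on_has_derivative:
  assumes "smooth_on S f" "x \<in> S"
  shows "(f has_derivative frechet_derivative f (at x)) (at x)"
proof -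
  have "Ck_on (Suc 0) S f" using assms unfolding smooth_on_def by blast
  then show ?thesis using assms(2) by (rule Ck_on_SucD)
qed

lemma smooth_on_vec_nth:
  fixes f :: "'a::real_normed_vector \<Rightarrow> real^'n"
  assumes "open S" "smooth_on S f"
  shows "smooth_on S (\<lambda>x. f x $ i)"
  using smooth_on_inner[OF assms smooth_on_const[of S "axis i 1"]] by (simp add: inner_axis)

lemma smooth_on_vec_lambda:
  fixes f :: "'n::finite \<Rightarrow> 'a::real_normed_vector \<Rightarrow> real"
  assumes "open S" "\<And>i. smooth_on S (f i)"
  shows "smooth_on S (\<lambda>x. \<chi> i. f i x)"
proof -
  have "(\<lambda>x. \<chi> i. f i x) = (\<lambda>x. \<Sum>i\<in>UNIV. f i x *\<^sub>R axis i 1)"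
    by (simp add: fun_eq_iff vec_eq_iff axis_def if_distrib cong: if_cong)
  then show ?thesis
    by (simp only:) (intro smooth_on_sum smooth_on_scaleR smooth_on_const assms)
qed

lemma smooth_on_det:
  fixes M :: "'a::real_normed_vector \<Rightarrow> real^'n^'n"
  assumes "open S" "\<And>i j. smooth_on S (\<lambda>x. M x $ i $ j)"
  shows "smooth_on S (\<lambda>x. det (M x))"
  unfolding det_def
  by (intro smooth_on_sum smooth_on_mult smooth_on_prod smooth_on_const assms)

section \<open>Bump functions on Euclidean space\<close>

definition flat_exp :: "nat \<Rightarrow> real \<Rightarrow> real" where
  "flat_exp n t = (if t > 0 then exp (- inverse t) / t ^ n else 0)"

lemma flat_exp_tendsto_0: "((\<lambda>t. flat_exp n t) \<longlongrightarrow> 0) (at 0)"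
proof -
  have "((\<lambda>t::real. exp (- inverse t) / t ^ n) \<longlongrightarrow> 0) (at_right 0)"
    by real_asymp
  then have "((\<lambda>t. flat_exp n t) \<longlongrightarrow> 0) (at_right 0)"
    by (rule Lim_transform_eventually)
      (auto simp: flat_exp_def eventually_at_right_less intro: eventually_at_rightI[of 0 1])
  moreover have "((\<lambda>t. flat_exp n t) \<longlongrightarrow> 0) (at_left 0)"
    by (rule Lim_transform_eventually[OF tendsto_const])
      (auto simp: flat_exp_def intro: eventually_at_leftI[of "-1"])
  ultimately show ?thesis by (simp add: filterlim_at_split)
qed

text \<open>Dividing by powers of t makes the family of these functions closed under differentiation
  up to linear combination, so smoothness of all members is a single induction on the order with n
  arbitrary. The bump itself uses n = 0.\<close>

lemma flat_exp_has_derivative: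
  "(flat_exp n has_real_derivative - real n * flat_exp (Suc n) t + flat_exp (n + 2) t) (at t)"
proof (cases t "0::real" rule: linorder_cases)
  case less
  have "((\<lambda>_. 0) has_real_derivative 0) (at t)" by simp
  then have "(flat_exp n has_real_derivative 0) (at t)"
    by (rule has_field_derivative_transform_within_open[where S = "{..<0}"])
      (use less in \<open>auto simp: flat_exp_def\<close>)
  then show ?thesis using less by (simp add: flat_exp_def)
next
  case equal
  \<comment> \<open>At the origin the difference quotient is the next member of the family, whose
    limit is 0; for h = 0 both sides are 0 because division by zero gives 0.\<close>
  have "flat_exp n h / h = flat_exp (Suc n) h" for h by (simp add: flat_exp_def)
  then have "(flat_exp n has_real_derivative 0) (at 0)"
    using flat_exp_tendsto_0[of "Suc n"] by (simp add: DERIV_def flat_exp_def)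
  then show ?thesis using equal by (simp add: flat_exp_def)
next
  case greater
  let ?u = "inverse t"
  have "((\<lambda>t. - inverse t) has_real_derivative ?u\<^sup>2) (at t)"
    using DERIV_minus[OF DERIV_inverse[of t]] greater by (simp add: numeral_2_eq_2)
  from DERIV_fun_exp[OF this]
  have "((\<lambda>t. exp (- inverse t)) has_real_derivative exp (- ?u) * ?u\<^sup>2) (at t)" .
  moreover have "((\<lambda>t. inverse t ^ n) has_real_derivative
      real n * (- ?u\<^sup>2 * ?u ^ (n - Suc 0))) (at t)"
    using DERIV_power[OF DERIV_inverse[of t], of n] greater by (simp add: numeral_2_eq_2)
  ultimately have "((\<lambda>t. exp (- inverse t) * inverse t ^ n) has_real_derivative
      exp (- ?u) * ?u\<^sup>2 * ?u ^ n + real n * (- ?u\<^sup>2 * ?u ^ (n - Suc 0)) * exp (- ?u)) (at t)"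
    by (rule DERIV_mult)
  also have "exp (- ?u) * ?u\<^sup>2 * ?u ^ n + real n * (- ?u\<^sup>2 * ?u ^ (n - Suc 0)) * exp (- ?u) =
      - real n * flat_exp (Suc n) t + flat_exp (n + 2) t"
    using greater
    by (cases n) (simp_all add: flat_exp_def divide_inverse power_inverse[symmetric]
        power2_eq_square algebra_simps)
  finally show ?thesis
    by (rule has_field_derivative_transform_within_open[where S = "{0<..}"])
      (use greater in \<open>auto simp: flat_exp_def divide_inverse power_inverse\<close>)
qed

lemma smooth_on_flat_exp: "smooth_on UNIV (flat_exp n)"
proof -
  have "Ck_on k UNIV (flat_exp n)" for k n
  proof (induction k arbitrary: n)
    case 0
    show ?case
      using DERIV_isCont[OF flat_exp_has_derivative] by (simp add: continuous_on_eq_continuous_at)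
  next
    case (Suc k)
    note mult = bounded_bilinear.Ck_on_bilinear[OF bounded_bilinear_mult open_UNIV]
    show ?case
      by (rule Ck_on_SucI[OF open_UNIV
            flat_exp_has_derivative[unfolded has_field_derivative_def]])
        (intro mult Ck_on_add Ck_on_const open_UNIV Suc.IH)
  qed
  then show ?thesis by (simp add: smooth_on_def)
qed

text \<open>The squared distance is a polynomial in x, so no problem of differentiability arises at
  the centre.\<close>

definition ball_bump :: "'a::euclidean_space \<Rightarrow> real \<Rightarrow> 'a \<Rightarrow> real" where
  "ball_bump x0 r x = flat_exp 0 (r\<^sup>2 - (x - x0) \<bullet> (x - x0))"

lemma ball_bump_nonzero_iff:
  assumes "r > 0"
  shows "ball_bump x0 r x \<noteq> 0 \<longleftrightarrow> x \<in> ball x0 r"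
proof -
  have "(x - x0) \<bullet> (x - x0) = (dist x0 x)\<^sup>2"
    by (simp add: dist_norm norm_minus_commute power2_norm_eq_inner)
  moreover have "r\<^sup>2 - (dist x0 x)\<^sup>2 > 0 \<longleftrightarrow> dist x0 x < r"
    using assms by (smt (verit) power_less_imp_less_base power_strict_mono zero_less_numeral zero_le_dist)
  ultimately show ?thesis
    by (simp add: ball_bump_def flat_exp_def)
qed

lemma smooth_on_ball_bump: "smooth_on UNIV (ball_bump x0 r)"
proof -
  have lin: "smooth_on UNIV (\<lambda>x. x + - x0)"
    by (intro smooth_on_add smooth_on_const smooth_on_bounded_linear bounded_linear_ident open_UNIV)
  have "smooth_on UNIV (\<lambda>x. r\<^sup>2 + -1 * ((x + - x0) \<bullet> (x + - x0)))"
    by (intro smooth_on_add smooth_on_mult smooth_on_inner smooth_on_const lin open_UNIV)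
  from smooth_on_compose[OF open_UNIV open_UNIV smooth_on_flat_exp this]
  show ?thesis by (simp add: ball_bump_def[abs_def])
qed

subsection \<open>Vector fields and local frames\<close>

lemma sum_fun_apply: "(\<Sum>i\<in>I. f i) x = (\<Sum>i\<in>I. f i x)"
  by (induction I rule: infinite_finite_induct) auto

locale smooth_manifold =
  fixes A :: "('a::{t2_space,second_countable_topology}, 'n::finite) chart set"
  assumes atlas: "smooth_atlas A"
begin

lemma covering: obtains c where "c \<in> A" "p \<in> fst c"
  using atlas unfolding smooth_atlas_def by blast

lemma open_chart_domain: "c \<in> A \<Longrightarrow> open (fst c)"
  and open_chart_image: "c \<in> A \<Longrightarrow> open (snd c ` fst c)"
  and chart_homeomorphism:
    "c \<in> A \<Longrightarrow> homeomorphism (fst c) (snd c ` fst c) (snd c) (chart_inv c)"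
  and smooth_transition:
    "c \<in> A \<Longrightarrow> d \<in> A \<Longrightarrow> smooth_on (snd c ` (fst c \<inter> fst d)) (transition c d)"
  using atlas by (auto simp: smooth_atlas_def)

lemma chart_inv_chart [simp]: "c \<in> A \<Longrightarrow> p \<in> fst c \<Longrightarrow> chart_inv c (snd c p) = p"
  using chart_homeomorphism by (auto simp: homeomorphism_def)

lemma transition_chart [simp]: "c \<in> A \<Longrightarrow> p \<in> fst c \<Longrightarrow> transition c d (snd c p) = snd d p"
  by (simp add: transition_def)

lemma open_chart_image_subset:
  assumes "c \<in> A" "open W" "W \<subseteq> fst c"
  shows "open (snd c ` W)"
proof -
  have "continuous_on (snd c ` fst c) (chart_inv c)"
    using chart_homeomorphism[OF assms(1)] by (simp add: homeomorphism_def)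
  then have "open (snd c ` fst c \<inter> chart_inv c -` W)"
    using open_chart_image[OF assms(1)] assms(2) by (rule continuous_open_preimage)
  moreover have "snd c ` fst c \<inter> chart_inv c -` W = snd c ` W"
    using assms(1,3) by force
  ultimately show ?thesis by simp
qed

lemma open_overlap: "c \<in> A \<Longrightarrow> d \<in> A \<Longrightarrow> open (snd c ` (fst c \<inter> fst d))"
  by (intro open_chart_image_subset open_Int open_chart_domain) auto

section \<open>Derivatives of transition maps and tangent spaces\<close>

lemma transition_has_derivative:
  assumes "c \<in> A" "d \<in> A" "p \<in> fst c" "p \<in> fst d"
  shows "(transition c d has_derivative frechet_derivative (transition c d) (at (snd c p)))
    (at (snd c p))"
  using smooth_on_has_derivative[OF smooth_transition[OF assms(1,2)]] assms(3,4) by blast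

text \<open>On the overlap of \<open>c\<close> and \<open>d\<close> the composite of the two
  transition maps is \<open>transition c e\<close>, so this is the chain rule. It is the cocycle
  identity that places \<open>tangent_vector\<close> in the tangent space.\<close>

lemma frechet_transition_compose:
  assumes "c \<in> A" "d \<in> A" "e \<in> A" "p \<in> fst c" "p \<in> fst d" "p \<in> fst e"
  shows "frechet_derivative (transition d e) (at (snd d p))
      (frechet_derivative (transition c d) (at (snd c p)) v) =
    frechet_derivative (transition c e) (at (snd c p)) v"
proof -
  have "((\<lambda>y. transition d e (transition c d y)) has_derivative
      (\<lambda>v. frechet_derivative (transition d e) (at (snd d p))
        (frechet_derivative (transition c d) (at (snd c p)) v))) (at (snd c p))"
    using has_derivative_compose[OF transition_has_derivative[of c d p], of "transition d e"]
      transition_has_derivative[of d e p] assms by simp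
  then have "(transition c e has_derivative
      (\<lambda>v. frechet_derivative (transition d e) (at (snd d p))
        (frechet_derivative (transition c d) (at (snd c p)) v))) (at (snd c p))"
    by (rule has_derivative_transform_within_open[OF _ open_overlap[OF assms(1,2)]])
      (use assms in auto)
  from frechet_derivative_at[OF this] show ?thesis by metis
qed

lemma frechet_transition_self:
  assumes "c \<in> A" "p \<in> fst c"
  shows "frechet_derivative (transition c c) (at (snd c p)) v = v"
proof -
  have "(transition c c has_derivative (\<lambda>v. v)) (at (snd c p))"
    by (rule has_derivative_transform_within_open[OF has_derivative_ident
          open_chart_image[OF assms(1)]])
      (use assms in auto)
  from frechet_derivative_at[OF this] show ?thesis by metis
qed

lemma linear_frechet_transition:
  assumes "c \<in> A" "d \<in> A" "p \<in> fst c" "p \<in> fst d"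
  shows "linear (frechet_derivative (transition c d) (at (snd c p)))"
  using transition_has_derivative[OF assms] has_derivative_linear by blast

definition tangent_vector :: "('a, 'n) chart \<Rightarrow> 'a \<Rightarrow> real^'n \<Rightarrow> ('a, 'n) tvec" where
  "tangent_vector c p v =
    (\<lambda>d. if d \<in> A \<and> p \<in> fst d then frechet_derivative (transition c d) (at (snd c p)) v else 0)"

lemma tangent_vector_in:
  "c \<in> A \<Longrightarrow> p \<in> fst c \<Longrightarrow> tangent_vector c p v \<in> tangent_space A p"
  by (auto simp: tangent_space_def tangent_vector_def frechet_transition_compose)

lemma tangent_vector_chart [simp]:
  "c \<in> A \<Longrightarrow> p \<in> fst c \<Longrightarrow> tangent_vector c p v c = v"
  by (simp add: tangent_vector_def frechet_transition_self)

lemma tangent_spaceI: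
  assumes "\<And>c. \<not> (c \<in> A \<and> p \<in> fst c) \<Longrightarrow> v c = 0"
    and "\<And>c d. c \<in> A \<Longrightarrow> d \<in> A \<Longrightarrow> p \<in> fst c \<Longrightarrow> p \<in> fst d \<Longrightarrow>
      frechet_derivative (transition c d) (at (snd c p)) (v c) = v d"
  shows "v \<in> tangent_space A p"
  unfolding tangent_space_def
  by (intro CollectI conjI allI ballI impI assms(2)[symmetric] assms(1); blast)

lemma tangent_space_outside:
  "v \<in> tangent_space A p \<Longrightarrow> \<not> (c \<in> A \<and> p \<in> fst c) \<Longrightarrow> v c = 0"
  unfolding tangent_space_def by blast

lemma tangent_space_transition:
  assumes "v \<in> tangent_space A p" "c \<in> A" "d \<in> A" "p \<in> fst c" "p \<in> fst d"
  shows "frechet_derivative (transition c d) (at (snd c p)) (v c) = v d"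
proof -
  have "\<forall>c\<in>A. \<forall>d\<in>A. p \<in> fst c \<inter> fst d \<longrightarrow>
      v d = frechet_derivative (transition c d) (at (snd c p)) (v c)"
    using assms(1) unfolding tangent_space_def mem_Collect_eq by (rule conjunct2)
  then show ?thesis using assms(2-5) by (metis IntI)
qed

text \<open>One chart around p determines a tangent vector: the entries at the other charts around p
  are images under transition derivatives, and all remaining entries are 0 by convention.\<close>

lemma tangent_space_eqI:
  assumes "c \<in> A" "p \<in> fst c" "v \<in> tangent_space A p" "w \<in> tangent_space A p" "v c = w c"
  shows "v = w"
proof
  fix d
  show "v d = w d"
  proof (cases "d \<in> A \<and> p \<in> fst d")
    case True
    then show ?thesis
      using assms tangent_space_transition[of v p c d] tangent_space_transition[of w p c d] by metis
  next
    case False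
    then show ?thesis
      using assms tangent_space_outside by metis
  qed
qed

lemma tangent_space_zero: "0 \<in> tangent_space A p"
  by (rule tangent_spaceI) (simp_all add: linear_0[OF linear_frechet_transition])

lemma tangent_space_add:
  "v \<in> tangent_space A p \<Longrightarrow> w \<in> tangent_space A p \<Longrightarrow> v + w \<in> tangent_space A p"
  by (rule tangent_spaceI)
    (simp_all add: tangent_space_outside tangent_space_transition
      linear_add[OF linear_frechet_transition])

lemma tangent_space_scale:
  "v \<in> tangent_space A p \<Longrightarrow> (\<lambda>c. a *\<^sub>R v c) \<in> tangent_space A p"
  by (rule tangent_spaceI)
    (simp_all add: tangent_space_outside tangent_space_transition
      linear_cmul[OF linear_frechet_transition])

lemma vector_fields_zero: "0 \<in> vector_fields A"
  by (auto simp: vector_fields_def tangent_space_zero smooth_on_const)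

lemma vector_fields_add:
  "X \<in> vector_fields A \<Longrightarrow> Y \<in> vector_fields A \<Longrightarrow> X + Y \<in> vector_fields A"
  by (auto simp: vector_fields_def tangent_space_add smooth_on_add open_chart_image)

lemma vector_fields_scale:
  "f \<in> smooth_functions A \<Longrightarrow> X \<in> vector_fields A \<Longrightarrow> vf_scale f X \<in> vector_fields A"
  by (auto simp: vector_fields_def vf_scale_def smooth_functions_def tangent_space_scale comp_def
      smooth_on_scaleR open_chart_image)

lemma vector_fields_sum:
  "(\<And>i. i \<in> I \<Longrightarrow> X i \<in> vector_fields A) \<Longrightarrow> (\<Sum>i\<in>I. X i) \<in> vector_fields A"
  by (induction I rule: infinite_finite_induct) (auto simp: vector_fields_zero vector_fields_add)

lemma smooth_functions_const: "(\<lambda>p. a) \<in> smooth_functions A"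
  by (simp add: smooth_functions_def comp_def smooth_on_const)

lemma smooth_functions_zero: "0 \<in> smooth_functions A"
  using smooth_functions_const[of 0] by (simp add: zero_fun_def)

lemma smooth_functions_add:
  "f \<in> smooth_functions A \<Longrightarrow> g \<in> smooth_functions A \<Longrightarrow> f + g \<in> smooth_functions A"
  by (auto simp: smooth_functions_def comp_def smooth_on_add open_chart_image)

lemma smooth_functions_mult:
  "f \<in> smooth_functions A \<Longrightarrow> g \<in> smooth_functions A \<Longrightarrow> f * g \<in> smooth_functions A"
  by (auto simp: smooth_functions_def comp_def smooth_on_mult open_chart_image)

section \<open>Local criteria for smooth functions and vector fields\<close>

lemma smooth_change_chart:
  assumes "c \<in> A" "d \<in> A" "open W" "W \<subseteq> fst c"
    and "smooth_on (snd c ` W) (\<lambda>y. f (chart_inv c y))"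
  shows "smooth_on (snd d ` (W \<inter> fst d)) (\<lambda>y. f (chart_inv d y))"
proof -
  have op: "open (snd d ` (W \<inter> fst d))"
    using assms by (intro open_chart_image_subset open_Int open_chart_domain) auto
  have "smooth_on (snd d ` (W \<inter> fst d)) (transition d c)"
    by (rule smooth_on_subset[OF smooth_transition[OF assms(2,1)]]) (use assms in auto)
  then have "smooth_on (snd d ` (W \<inter> fst d)) (\<lambda>y. f (chart_inv c (transition d c y)))"
    by (rule smooth_on_compose[OF op open_chart_image_subset[OF assms(1,3,4)] assms(5)])
      (use assms in auto)
  then show ?thesis
    by (rule smooth_on_cong[OF op, rotated]) (use assms in \<open>auto simp: subset_iff\<close>)
qed

text \<open>The definition asks for smoothness in every chart; here one chart around each point is
  enough, since a change of chart is composition with a smooth transition map. This is what makes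
  extension by zero easy to check.\<close>

lemma smooth_functionsI:
  assumes "\<And>p. \<exists>c\<in>A. \<exists>W. open W \<and> p \<in> W \<and> W \<subseteq> fst c \<and>
    smooth_on (snd c ` W) (\<lambda>y. f (chart_inv c y))"
  shows "f \<in> smooth_functions A"
  unfolding smooth_functions_def comp_def
proof (intro CollectI ballI smooth_on_local)
  fix d y assume d: "d \<in> A" and "y \<in> snd d ` fst d"
  then obtain p where p: "p \<in> fst d" "y = snd d p" by auto
  obtain c W where W: "c \<in> A" "open W" "p \<in> W" "W \<subseteq> fst c"
    "smooth_on (snd c ` W) (\<lambda>y. f (chart_inv c y))"
    using assms by blast
  have "open (snd d ` (W \<inter> fst d))"
    using W d by (intro open_chart_image_subset open_Int open_chart_domain) auto
  then show "\<exists>N. open N \<and> y \<in> N \<and> smooth_on N (\<lambda>x. f (chart_inv d x))"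
    using smooth_change_chart[OF W(1) d W(2,4,5)] p W(3) by blast
qed

text \<open>Unlike for functions, a change of chart also multiplies the components by the Jacobian
  of the transition map. The sum over \<open>Basis\<close> writes the new components as old
  components times fixed-direction derivatives, each of which is smooth.\<close>

lemma vector_fieldsI:
  assumes tangent: "\<And>p. X p \<in> tangent_space A p"
    and "\<And>p. \<exists>c\<in>A. \<exists>W. open W \<and> p \<in> W \<and> W \<subseteq> fst c \<and>
      smooth_on (snd c ` W) (\<lambda>y. X (chart_inv c y) c)"
  shows "X \<in> vector_fields A"
  unfolding vector_fields_def
proof (intro CollectI conjI allI ballI tangent smooth_on_local)
  fix d y assume d: "d \<in> A" and "y \<in> snd d ` fst d"
  then obtain p where p: "p \<in> fst d" "y = snd d p" by auto
  obtain c W where W: "c \<in> A" "open W" "p \<in> W" "W \<subseteq> fst c"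
    "smooth_on (snd c ` W) (\<lambda>y. X (chart_inv c y) c)"
    using assms(2) by blast
  let ?N = "snd d ` (W \<inter> fst d)"
  let ?D = "\<lambda>y b. frechet_derivative (transition c d) (at (transition d c y)) b"
  have op: "open ?N"
    using W d by (intro open_chart_image_subset open_Int open_chart_domain) auto
  have "smooth_on ?N (transition d c)"
    by (rule smooth_on_subset[OF smooth_transition[OF d W(1)]]) (use W in auto)
  then have "smooth_on ?N (\<lambda>y. ?D y b)" for b
    by (rule smooth_on_compose[OF op open_overlap[OF W(1) d]
          smooth_on_frechet_derivative[OF smooth_transition[OF W(1) d]]])
      (use W d in auto)
  then have sm: "smooth_on ?N (\<lambda>y. \<Sum>b\<in>Basis. (X (chart_inv d y) c \<bullet> b) *\<^sub>R ?D y b)"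
    by (intro smooth_on_sum smooth_on_scaleR smooth_on_inner smooth_on_const op
        smooth_change_chart[OF W(1) d W(2,4), where f = "\<lambda>p. X p c"] W(5))
  have eq: "(\<Sum>b\<in>Basis. (X (chart_inv d y) c \<bullet> b) *\<^sub>R ?D y b) = X (chart_inv d y) d"
    if "y \<in> ?N" for y
  proof -
    obtain q where q: "q \<in> W" "q \<in> fst d" "y = snd d q" using \<open>y \<in> ?N\<close> by auto
    have qc: "q \<in> fst c" using q W by auto
    have "X q d = frechet_derivative (transition c d) (at (snd c q)) (X q c)"
      using tangent_space_transition[OF tangent[of q] W(1) d qc q(2)] by simp
    also have "\<dots> = (\<Sum>b\<in>Basis. (X q c \<bullet> b) *\<^sub>R
        frechet_derivative (transition c d) (at (snd c q)) b)"
      by (rule linear_eq_sum_Basis[OF linear_frechet_transition[OF W(1) d qc q(2)]])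
    finally show ?thesis using q d W by simp
  qed
  have "smooth_on ?N (\<lambda>y. X (chart_inv d y) d)"
    by (rule smooth_on_cong[OF op eq sm])
  then show "\<exists>N. open N \<and> y \<in> N \<and> smooth_on N (\<lambda>x. X (chart_inv d x) d)"
    using op p W(3) by blast
qed

text \<open>
  A frame over \<open>N\<close> is the coordinate frame of \<open>c\<close> multiplied by a cut-off function \<open>h\<close>, so that it
  consists of global vector fields; \<open>h\<close> is not normalised to \<open>1\<close> on \<open>N\<close>, being nonzero is enough.
\<close>

definition local_frame ::
  "('a, 'n) chart \<Rightarrow> 'a set \<Rightarrow> ('a \<Rightarrow> real) \<Rightarrow> ('n \<Rightarrow> ('a, 'n) vfield) \<Rightarrow> bool" where
  "local_frame c N h E \<longleftrightarrow> c \<in> A \<and> open N \<and> N \<subseteq> fst c \<and> (\<forall>p\<in>N. h p \<noteq> 0) \<and>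
    (\<forall>u. smooth_on (snd c ` fst c) (\<lambda>y. u (chart_inv c y)) \<longrightarrow>
      (\<lambda>p. h p * u p) \<in> smooth_functions A) \<and>
    (\<forall>i. E i \<in> vector_fields A) \<and>
    (\<forall>p i. p \<in> fst c \<longrightarrow> E i p c = h p *\<^sub>R axis i 1) \<and>
    (\<forall>p i. p \<notin> fst c \<longrightarrow> h p = 0 \<and> E i p = 0)"

text \<open>The danger is the boundary of the chart domain, where the extension by zero must stay
  smooth. The bump vanishes off a closed ball inside the chart image; the preimage \<open>?K\<close>
  of that ball is compact, hence closed because the manifold is Hausdorff. A point outside the chart
  domain therefore has a neighbourhood missing \<open>?K\<close>, on which \<open>h\<close> and all
  \<open>E i\<close> are 0.\<close>

lemma local_frame_exists:
  assumes c: "c \<in> A" and p0: "p0 \<in> fst c"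
  obtains N h E where "local_frame c N h E" "p0 \<in> N"
proof -
  obtain r where r: "r > 0" "cball (snd c p0) r \<subseteq> snd c ` fst c"
    using open_chart_image[OF c] p0 by (auto simp: open_contains_cball)
  define \<psi> where "\<psi> = ball_bump (snd c p0) r"
  define h where "h = (\<lambda>p. if p \<in> fst c then \<psi> (snd c p) else 0)"
  define E where "E = (\<lambda>i p. if p \<in> fst c then tangent_vector c p (h p *\<^sub>R axis i 1) else 0)"
  define N where "N = fst c \<inter> snd c -` ball (snd c p0) r"
  let ?K = "chart_inv c ` cball (snd c p0) r"
  have "continuous_on (snd c ` fst c) (chart_inv c)"
    using chart_homeomorphism[OF c] by (simp add: homeomorphism_def)
  then have "compact ?K"
    using r by (intro compact_continuous_image) (auto intro: continuous_on_subset)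
  then have K: "closed ?K" by (rule compact_imp_closed)
  have K_sub: "?K \<subseteq> fst c" using r(2) c by auto
  have h0: "h p = 0" if "p \<notin> ?K" for p
  proof (cases "p \<in> fst c")
    case True
    then have "snd c p \<notin> ball (snd c p0) r"
      using that c by (metis chart_inv_chart ball_subset_cball image_eqI subsetD)
    then show ?thesis
      using ball_bump_nonzero_iff[OF r(1)] by (auto simp: h_def \<psi>_def)
  qed (simp add: h_def)
  have \<psi>: "smooth_on (snd c ` fst c) \<psi>"
    unfolding \<psi>_def by (rule smooth_on_subset[OF smooth_on_ball_bump]) simp
  have h_chart: "smooth_on (snd c ` fst c) (\<lambda>y. h (chart_inv c y))"
    by (rule smooth_on_cong[OF open_chart_image[OF c] _ \<psi>]) (use c in \<open>auto simp: h_def\<close>)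
  have outside: "\<exists>d\<in>A. \<exists>W. open W \<and> p \<in> W \<and> W \<subseteq> fst d \<and> W \<inter> ?K = {}" if "p \<notin> fst c" for p
  proof -
    obtain d where d: "d \<in> A" "p \<in> fst d" by (rule covering)
    then show ?thesis
      using open_Diff[OF open_chart_domain[OF d(1)] K] that K_sub
      by (intro bexI[of _ d] exI[of _ "fst d - ?K"]) auto
  qed
  have mult: "(\<lambda>p. h p * u p) \<in> smooth_functions A"
    if u: "smooth_on (snd c ` fst c) (\<lambda>y. u (chart_inv c y))" for u
  proof (rule smooth_functionsI)
    fix p
    show "\<exists>c\<in>A. \<exists>W. open W \<and> p \<in> W \<and> W \<subseteq> fst c \<and>
      smooth_on (snd c ` W) (\<lambda>y. h (chart_inv c y) * u (chart_inv c y))"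
    proof (cases "p \<in> fst c")
      case True
      then show ?thesis
        using smooth_on_mult[OF open_chart_image[OF c] h_chart u] open_chart_domain[OF c] c by blast
    next
      case False
      then obtain d W where W: "d \<in> A" "open W" "p \<in> W" "W \<subseteq> fst d" "W \<inter> ?K = {}"
        using outside by metis
      have "smooth_on (snd d ` W) (\<lambda>y. h (chart_inv d y) * u (chart_inv d y))"
        by (rule smooth_on_cong[OF open_chart_image_subset[OF W(1,2,4)] _ smooth_on_const[of _ 0]])
          (use W h0 in \<open>auto simp: subset_iff disjoint_iff\<close>)
      with W show ?thesis by blast
    qed
  qed
  have E_chart: "E i p c = h p *\<^sub>R axis i 1" if "p \<in> fst c" for i p
    using that c by (simp add: E_def)
  have E_tangent: "E i p \<in> tangent_space A p" for i p
    using c by (simp add: E_def tangent_vector_in tangent_space_zero)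
  have E0: "E i p = 0" if "p \<notin> ?K" for i p
  proof (cases "p \<in> fst c")
    case True
    then show ?thesis
      using tangent_space_eqI[OF c True E_tangent tangent_space_zero] E_chart h0[OF that] by simp
  qed (simp add: E_def)
  have E: "E i \<in> vector_fields A" for i
  proof (rule vector_fieldsI[OF E_tangent])
    fix p
    show "\<exists>c\<in>A. \<exists>W. open W \<and> p \<in> W \<and> W \<subseteq> fst c \<and>
      smooth_on (snd c ` W) (\<lambda>y. E i (chart_inv c y) c)"
    proof (cases "p \<in> fst c")
      case True
      have "smooth_on (snd c ` fst c) (\<lambda>y. E i (chart_inv c y) c)"
        by (rule smooth_on_cong[OF open_chart_image[OF c] _
              smooth_on_scaleR[OF open_chart_image[OF c] h_chart smooth_on_const[of _ "axis i 1"]]])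
          (use c E_chart in auto)
      then show ?thesis using True open_chart_domain[OF c] c by blast
    next
      case False
      then obtain d W where W: "d \<in> A" "open W" "p \<in> W" "W \<subseteq> fst d" "W \<inter> ?K = {}"
        using outside by metis
      have "smooth_on (snd d ` W) (\<lambda>y. E i (chart_inv d y) d)"
        by (rule smooth_on_cong[OF open_chart_image_subset[OF W(1,2,4)] _ smooth_on_const[of _ 0]])
          (use W E0 in \<open>auto simp: subset_iff disjoint_iff\<close>)
      with W show ?thesis by blast
    qed
  qed
  have N: "open N"
    using chart_homeomorphism[OF c] open_chart_domain[OF c]
    by (auto simp: N_def homeomorphism_def intro!: continuous_open_preimage)
  have N_sub: "N \<subseteq> fst c" by (auto simp: N_def)
  have hN: "h p \<noteq> 0" if "p \<in> N" for p
    using that ball_bump_nonzero_iff[OF r(1)] by (auto simp: N_def h_def \<psi>_def)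
  have "p0 \<in> N" using p0 r(1) by (simp add: N_def)
  moreover have "local_frame c N h E"
    unfolding local_frame_def
    using c N N_sub hN mult E E_chart by (auto simp: h_def E_def)
  ultimately show ?thesis using that by blast
qed

lemma local_frame_cutoff_smooth:
  assumes "local_frame c N h E"
  shows "h \<in> smooth_functions A"
proof -
  have "\<forall>u. smooth_on (snd c ` fst c) (\<lambda>y. u (chart_inv c y)) \<longrightarrow>
      (\<lambda>p. h p * u p) \<in> smooth_functions A"
    using assms by (simp add: local_frame_def)
  from spec[OF this, of "\<lambda>_. 1"] show ?thesis by (simp add: smooth_on_const)
qed

text \<open>One factor \<open>h\<close> turns the components of \<open>Y\<close>, defined by the
  chart \<open>c\<close> alone, into global smooth functions; the other is already contained in
  \<open>E i\<close>. Off the chart domain \<open>h\<close> is 0 and both sides vanish, so the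
  identity holds globally and a function-linear map can be applied to it.\<close>

lemma vector_field_expansion:
  assumes E: "local_frame c N h E" and Y: "Y \<in> vector_fields A"
  shows "vf_scale (\<lambda>p. h p * h p) Y = (\<Sum>i\<in>UNIV. vf_scale (\<lambda>p. h p * Y p c $ i) (E i))"
    and "(\<lambda>p. h p * h p) \<in> smooth_functions A"
    and "(\<lambda>p. h p * Y p c $ i) \<in> smooth_functions A"
proof -
  have c: "c \<in> A" and E_vf: "E i \<in> vector_fields A" for i
    using E by (auto simp: local_frame_def)
  have mult: "(\<lambda>p. h p * u p) \<in> smooth_functions A"
    if "smooth_on (snd c ` fst c) (\<lambda>y. u (chart_inv c y))" for u
    using E that by (auto simp: local_frame_def)
  have Yi: "smooth_on (snd c ` fst c) (\<lambda>y. Y (chart_inv c y) c $ i)" for i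
    using Y c by (auto simp: vector_fields_def intro!: smooth_on_vec_nth open_chart_image)
  show comp: "(\<lambda>p. h p * Y p c $ i) \<in> smooth_functions A" for i
    using mult[of "\<lambda>p. Y p c $ i", OF Yi] .
  show hh: "(\<lambda>p. h p * h p) \<in> smooth_functions A"
    using smooth_functions_mult[of h h] local_frame_cutoff_smooth[OF E] by (simp add: times_fun_def)
  let ?R = "\<Sum>i\<in>UNIV. vf_scale (\<lambda>p. h p * Y p c $ i) (E i)"
  have R: "?R \<in> vector_fields A"
    by (intro vector_fields_sum vector_fields_scale comp E_vf)
  have L: "vf_scale (\<lambda>p. h p * h p) Y \<in> vector_fields A"
    by (intro vector_fields_scale hh Y)
  show "vf_scale (\<lambda>p. h p * h p) Y = ?R"
  proof
    fix p
    show "vf_scale (\<lambda>p. h p * h p) Y p = ?R p"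
    proof (cases "p \<in> fst c")
      case True
      have "?R p c = (\<Sum>i\<in>UNIV. (h p * h p) *\<^sub>R (Y p c $ i *\<^sub>R axis i 1))"
        using E True by (simp add: sum_fun_apply vf_scale_def local_frame_def mult_ac)
      also have "\<dots> = (h p * h p) *\<^sub>R (\<Sum>i\<in>UNIV. Y p c $ i *\<^sub>R axis i 1)"
        by (rule scaleR_sum_right[symmetric])
      also have "(\<Sum>i\<in>UNIV. Y p c $ i *\<^sub>R axis i 1) = Y p c"
        using basis_expansion[of "Y p c"] by (simp add: scalar_mult_eq_scaleR)
      finally have "vf_scale (\<lambda>p. h p * h p) Y p c = ?R p c"
        by (simp add: vf_scale_def)
      then show ?thesis
        using L R by (intro tangent_space_eqI[OF c True]) (auto simp: vector_fields_def)
    next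
      case False
      then have "h p = 0" using E by (simp add: local_frame_def)
      then show ?thesis by (intro ext) (simp add: sum_fun_apply vf_scale_def)
    qed
  qed
qed

section \<open>Locality of function-linear maps\<close>

abbreviation function_linear :: "('a, 'n) oneform \<Rightarrow> bool" where
  "function_linear \<equiv>
    fun_linear (smooth_functions A) vf_scale (vector_fields A) (*) (smooth_functions A)"

lemma function_linear_zero:
  assumes "function_linear \<omega>"
  shows "\<omega> 0 = 0"
proof -
  have "\<omega> (vf_scale 0 0) = 0 * \<omega> 0"
    using assms smooth_functions_zero vector_fields_zero unfolding fun_linear_def by blast
  moreover have "vf_scale 0 (0 :: ('a, 'n) vfield) = 0"
    by (simp add: vf_scale_def zero_fun_def)
  ultimately show ?thesis by simp
qed

lemma function_linear_sum:
  assumes "function_linear \<omega>" "\<And>i. i \<in> I \<Longrightarrow> f i \<in> smooth_functions A"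
    and "\<And>i. i \<in> I \<Longrightarrow> X i \<in> vector_fields A"
  shows "\<omega> (\<Sum>i\<in>I. vf_scale (f i) (X i)) = (\<Sum>i\<in>I. f i * \<omega> (X i))"
  using assms(2,3)
proof (induction I rule: infinite_finite_induct)
  case (insert j I)
  have "\<omega> (vf_scale (f j) (X j) + (\<Sum>i\<in>I. vf_scale (f i) (X i))) =
      \<omega> (vf_scale (f j) (X j)) + \<omega> (\<Sum>i\<in>I. vf_scale (f i) (X i))"
    using assms(1) insert.prems
    by (simp add: fun_linear_def vector_fields_sum vector_fields_scale)
  also have "\<omega> (vf_scale (f j) (X j)) = f j * \<omega> (X j)"
    using assms(1) insert.prems by (simp add: fun_linear_def)
  finally show ?case using insert by simp
qed (simp_all add: function_linear_zero[OF assms(1)])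

lemma function_linear_expansion:
  assumes "local_frame c N h E" "Y \<in> vector_fields A" "function_linear \<omega>"
  shows "h p * h p * \<omega> Y p = (\<Sum>i\<in>UNIV. h p * Y p c $ i * \<omega> (E i) p)"
proof -
  note exp = vector_field_expansion[OF assms(1,2)]
  have E: "E i \<in> vector_fields A" for i using assms(1) by (simp add: local_frame_def)
  have "(\<lambda>p. h p * h p) * \<omega> Y = \<omega> (vf_scale (\<lambda>p. h p * h p) Y)"
    using assms(2,3) exp(2) by (simp add: fun_linear_def)
  also have "\<dots> = (\<Sum>i\<in>UNIV. (\<lambda>p. h p * Y p c $ i) * \<omega> (E i))"
    unfolding exp(1) by (rule function_linear_sum[OF assms(3) exp(3) E])
  finally show ?thesis by (metis (mono_tags, lifting) sum_fun_apply sum.cong times_fun_def)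
qed

lemma function_linear_local:
  assumes "function_linear \<omega>" "Y \<in> vector_fields A" "Y p = 0"
  shows "\<omega> Y p = 0"
proof -
  obtain c where c: "c \<in> A" "p \<in> fst c" by (rule covering)
  then obtain N h E where E: "local_frame c N h E" "p \<in> N" by (rule local_frame_exists)
  then have "h p \<noteq> 0" by (auto simp: local_frame_def)
  then show ?thesis
    using function_linear_expansion[OF E(1) assms(2,1), of p] assms(3) by simp
qed

subsection \<open>Musical isomorphisms\<close>

lemma function_linear_comp:
  assumes "function_linear \<omega>"
    and "fun_linear (smooth_functions A) vf_scale (vector_fields A) vf_scale (vector_fields A) T"
  shows "function_linear (\<lambda>X. \<omega> (T X))"
  using assms by (simp add: fun_linear_def)

lemma one_formsI:
  assumes "function_linear \<omega>"
  shows "(\<lambda>X. if X \<in> vector_fields A then \<omega> X else 0) \<in> one_forms A"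
  using assms by (auto simp: one_forms_def fun_linear_def vector_fields_add vector_fields_scale)

lemma one_forms_linear: "\<xi> \<in> one_forms A \<Longrightarrow> function_linear \<xi>"
  and one_forms_outside: "\<xi> \<in> one_forms A \<Longrightarrow> X \<notin> vector_fields A \<Longrightarrow> \<xi> X = 0"
  by (auto simp: one_forms_def)

lemma one_forms_eqI:
  assumes "\<xi> \<in> one_forms A" "\<eta> \<in> one_forms A" "\<And>X. X \<in> vector_fields A \<Longrightarrow> \<xi> X = \<eta> X"
  shows "\<xi> = \<eta>"
proof
  fix X show "\<xi> X = \<eta> X"
    using assms one_forms_outside by (cases "X \<in> vector_fields A") auto
qed

lemma one_forms_zero: "0 \<in> one_forms A"
  by (auto simp: one_forms_def fun_linear_def smooth_functions_zero)

lemma one_forms_add: "\<xi> \<in> one_forms A \<Longrightarrow> \<eta> \<in> one_forms A \<Longrightarrow> \<xi> + \<eta> \<in> one_forms A"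
  by (auto simp: one_forms_def fun_linear_def smooth_functions_add algebra_simps)

lemma one_forms_scale:
  "f \<in> smooth_functions A \<Longrightarrow> \<xi> \<in> one_forms A \<Longrightarrow> form_scale f \<xi> \<in> one_forms A"
  by (auto simp: one_forms_def fun_linear_def form_scale_def smooth_functions_mult algebra_simps)

lemma dual_map_one_forms:
  assumes "fun_linear (smooth_functions A) vf_scale (vector_fields A) vf_scale (vector_fields A) F"
    and "\<xi> \<in> one_forms A"
  shows "dual_map A F \<xi> \<in> one_forms A"
  unfolding dual_map_def
  by (rule one_formsI[OF function_linear_comp[OF one_forms_linear[OF assms(2)] assms(1)]])

end

section \<open>Fibrewise linear algebra of a nondegenerate metric\<close>

locale metric_on_manifold = smooth_manifold A
  for A :: "('a::{t2_space,second_countable_topology}, 'n::finite) chart set" +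
  fixes g :: "('a, 'n) vf_form"
  assumes bilinear: "symmetric_bilinear (smooth_functions A) vf_scale (vector_fields A) g"
    and nondegenerate: "nondegenerate (vector_fields A) vf_vanishes g"
begin

lemma metric_linear_right: "X \<in> vector_fields A \<Longrightarrow> function_linear (g X)"
  and metric_linear_left: "X \<in> vector_fields A \<Longrightarrow> function_linear (\<lambda>Y. g Y X)"
  and metric_commute: "X \<in> vector_fields A \<Longrightarrow> Y \<in> vector_fields A \<Longrightarrow> g X Y = g Y X"
  using bilinear by (auto simp: symmetric_bilinear_def)

lemma metric_smooth:
  "X \<in> vector_fields A \<Longrightarrow> Y \<in> vector_fields A \<Longrightarrow> g X Y \<in> smooth_functions A"
  using metric_linear_right by (auto simp: fun_linear_def)

lemma metric_add_left:
  "X \<in> vector_fields A \<Longrightarrow> Y \<in> vector_fields A \<Longrightarrow> Z \<in> vector_fields A \<Longrightarrow>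
    g (X + Y) Z = g X Z + g Y Z"
  using metric_linear_left[of Z] by (simp add: fun_linear_def)

lemma metric_scale_left:
  "f \<in> smooth_functions A \<Longrightarrow> X \<in> vector_fields A \<Longrightarrow> Z \<in> vector_fields A \<Longrightarrow>
    g (vf_scale f X) Z = f * g X Z"
  using metric_linear_left[of Z] by (simp add: fun_linear_def)

lemma metric_scale_right:
  "f \<in> smooth_functions A \<Longrightarrow> X \<in> vector_fields A \<Longrightarrow> Z \<in> vector_fields A \<Longrightarrow>
    g Z (vf_scale f X) = f * g Z X"
  using metric_linear_right[of Z] by (simp add: fun_linear_def)

lemma metric_zero_left: "X \<in> vector_fields A \<Longrightarrow> g 0 X = 0"
  using function_linear_zero[OF metric_linear_left] by blast

text \<open>Fibrewise nondegeneracy applied to the difference of the fields. The difference is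
  written with the constant function -1 because bilinearity is given for sums and multiples by
  smooth functions.\<close>

lemma vector_field_eq_at:
  assumes "X \<in> vector_fields A" "Y \<in> vector_fields A"
    and "\<And>Z. Z \<in> vector_fields A \<Longrightarrow> g X Z p = g Y Z p"
  shows "X p = Y p"
proof -
  let ?D = "X + vf_scale (\<lambda>_. -1) Y"
  have Y: "vf_scale (\<lambda>_. -1) Y \<in> vector_fields A"
    by (intro vector_fields_scale smooth_functions_const assms)
  have "g ?D Z p = 0" if "Z \<in> vector_fields A" for Z
    using that assms Y by (simp add: metric_add_left metric_scale_left smooth_functions_const)
  moreover have "?D \<in> vector_fields A"
    using assms Y by (intro vector_fields_add)
  ultimately have "?D p = 0"
    using nondegenerate unfolding nondegenerate_def vf_vanishes_def by blast
  then show ?thesis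
    by (auto simp: vf_scale_def fun_eq_iff)
qed

text \<open>Locality of the metric in its first argument. It allows a field assembled from different
  global fields at different points to be replaced, at p, by the one chosen for p.\<close>

lemma metric_cong_at:
  assumes "X \<in> vector_fields A" "Y \<in> vector_fields A" "Z \<in> vector_fields A" "X p = Y p"
  shows "g X Z p = g Y Z p"
proof -
  let ?D = "X + vf_scale (\<lambda>_. -1) Y"
  have Y: "vf_scale (\<lambda>_. -1) Y \<in> vector_fields A"
    by (intro vector_fields_scale smooth_functions_const assms)
  have "?D p = 0" using assms(4) by (simp add: vf_scale_def fun_eq_iff)
  then have "g ?D Z p = 0"
    using function_linear_local[OF metric_linear_left[OF assms(3)] vector_fields_add[OF assms(1) Y]]
    by simp
  then show ?thesis
    using assms Y by (simp add: metric_add_left metric_scale_left smooth_functions_const)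
qed

text \<open>Rows belong to the second argument of the metric, so that
  \<open>gram_matrix E p *v x\<close> lists the pairings at p of the combination of the
  \<open>E j\<close> with coefficients x against each \<open>E i\<close>.\<close>

definition gram_matrix :: "('n \<Rightarrow> ('a, 'n) vfield) \<Rightarrow> 'a \<Rightarrow> real^'n^'n" where
  "gram_matrix E p = (\<chi> i j. g (E j) (E i) p)"

text \<open>Constant coefficients are globally smooth, so every coordinate vector x at a point of
  \<open>N\<close> is realised, up to the factor \<open>h p\<close>, by a global field; linear
  algebra in one fibre becomes a statement about sections.\<close>

lemma frame_combination:
  assumes E: "local_frame c N h E" and x: "Z = (\<Sum>j\<in>UNIV. vf_scale (\<lambda>_. x $ j) (E j))"
  shows "Z \<in> vector_fields A"
    and "p \<in> N \<Longrightarrow> Z p c = h p *\<^sub>R x"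
    and "Y \<in> vector_fields A \<Longrightarrow>
      h p * h p * g Z Y p = (\<Sum>i\<in>UNIV. h p * Y p c $ i * (gram_matrix E p *v x) $ i)"
proof -
  have E_vf: "E i \<in> vector_fields A" for i using E by (simp add: local_frame_def)
  show Z: "Z \<in> vector_fields A"
    unfolding x by (intro vector_fields_sum vector_fields_scale smooth_functions_const E_vf)
  show "Z p c = h p *\<^sub>R x" if "p \<in> N"
  proof -
    have "p \<in> fst c" using E that by (auto simp: local_frame_def)
    then have "Z p c = (\<Sum>j\<in>UNIV. h p *\<^sub>R (x $ j *\<^sub>R axis j 1))"
      using E by (simp add: x sum_fun_apply vf_scale_def local_frame_def mult_ac)
    also have "\<dots> = h p *\<^sub>R (\<Sum>j\<in>UNIV. x $ j *\<^sub>R axis j 1)"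
      by (rule scaleR_sum_right[symmetric])
    finally show ?thesis
      using basis_expansion[of x] by (simp add: scalar_mult_eq_scaleR)
  qed
  have "g Z (E i) p = (gram_matrix E p *v x) $ i" for i
  proof -
    have "g Z (E i) = (\<Sum>j\<in>UNIV. (\<lambda>_. x $ j) * g (E j) (E i))"
      unfolding x
      by (rule function_linear_sum[OF metric_linear_left[OF E_vf] smooth_functions_const E_vf])
    then show ?thesis
      by (simp add: sum_fun_apply gram_matrix_def matrix_vector_mult_def mult.commute)
  qed
  then show "h p * h p * g Z Y p = (\<Sum>i\<in>UNIV. h p * Y p c $ i * (gram_matrix E p *v x) $ i)"
    if "Y \<in> vector_fields A"
    using function_linear_expansion[OF E that metric_linear_right[OF Z], of p] by simp
qed

text \<open>A kernel vector x yields a field that is orthogonal at p to all fields. Nondegeneracy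
  makes it vanish at p, and since its coordinates there are \<open>h p *\<^sub>R x\<close> with
  \<open>h p\<close> nonzero, x is 0.\<close>

lemma det_gram_matrix_nonzero:
  assumes E: "local_frame c N h E" and p: "p \<in> N"
  shows "det (gram_matrix E p) \<noteq> 0"
proof -
  have h: "h p \<noteq> 0" using E p by (simp add: local_frame_def)
  have "x = 0" if "gram_matrix E p *v x = 0" for x
  proof -
    define Z where "Z = (\<Sum>j\<in>UNIV. vf_scale (\<lambda>_. x $ j) (E j))"
    note Z = frame_combination[OF E Z_def]
    have "g Z Y p = 0" if "Y \<in> vector_fields A" for Y
      using Z(3)[OF that, of p] h \<open>gram_matrix E p *v x = 0\<close> by simp
    then have "Z p = 0"
      using nondegenerate Z(1) unfolding nondegenerate_def vf_vanishes_def by blast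
    then show "x = 0" using Z(2)[OF p] h by simp
  qed
  then show ?thesis
    by (simp add: invertible_det_nz[symmetric] invertible_left_inverse matrix_left_invertible_ker)
qed

text \<open>The Gram system matches \<open>\<xi>\<close> only on the frame; the expansion of an
  arbitrary \<open>Y\<close> in the frame, divided by the nonzero square of \<open>h p\<close>,
  extends the equality to all fields at p.\<close>

lemma riesz_at:
  assumes E: "local_frame c N h E" and p: "p \<in> N" and \<xi>: "function_linear \<xi>"
    and x: "gram_matrix E p *v x = (\<chi> i. \<xi> (E i) p)"
  obtains Z where "Z \<in> vector_fields A" "Z p c = h p *\<^sub>R x"
    "\<And>Y. Y \<in> vector_fields A \<Longrightarrow> g Z Y p = \<xi> Y p"
proof -
  define Z where "Z = (\<Sum>j\<in>UNIV. vf_scale (\<lambda>_. x $ j) (E j))"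
  note Z = frame_combination[OF E Z_def]
  have "h p \<noteq> 0" using E p by (simp add: local_frame_def)
  moreover have "h p * h p * g Z Y p = h p * h p * \<xi> Y p" if "Y \<in> vector_fields A" for Y
    using Z(3)[OF that, of p] function_linear_expansion[OF E that \<xi>, of p] x by simp
  ultimately have "g Z Y p = \<xi> Y p" if "Y \<in> vector_fields A" for Y
    using that by simp
  with Z(1) Z(2)[OF p] show ?thesis by (rule that)
qed

text \<open>
  The vector field is determined pointwise by nondegeneracy; in a local frame its coefficients
  solve the Gram system, so Cramer's rule shows that they are smooth.
\<close>

lemma riesz:
  assumes \<xi>: "function_linear \<xi>"
  obtains X where "X \<in> vector_fields A" "\<And>Y. Y \<in> vector_fields A \<Longrightarrow> g X Y = \<xi> Y"
proof -
  define cramer_solution where "cramer_solution E p = (\<chi> k. det (\<chi> i j. if j = k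
      then (\<chi> i. \<xi> (E i) p) $ i else gram_matrix E p $ i $ j) / det (gram_matrix E p))" for E p
  have sol: "gram_matrix E p *v cramer_solution E p = (\<chi> i. \<xi> (E i) p)"
    if "local_frame c N h E" "p \<in> N" for c N h E p
    using cramer[OF det_gram_matrix_nonzero[OF that]] unfolding cramer_solution_def by blast
  have "\<exists>Z. Z \<in> vector_fields A \<and> (\<forall>Y\<in>vector_fields A. g Z Y p = \<xi> Y p)" for p
  proof -
    obtain c where c: "c \<in> A" "p \<in> fst c" by (rule covering)
    then obtain N h E where E: "local_frame c N h E" "p \<in> N" by (rule local_frame_exists)
    show ?thesis
      by (rule riesz_at[OF E \<xi> sol[OF E]]) blast
  qed
  then obtain Z where Z: "\<And>p. Z p \<in> vector_fields A"
      "\<And>p Y. Y \<in> vector_fields A \<Longrightarrow> g (Z p) Y p = \<xi> Y p"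
    by metis
  \<comment> \<open>The fields \<open>Z p\<close> are chosen independently for each p, and only the
    value of \<open>Z p\<close> at its own point is kept. Smoothness in p is thus lost and has to be
    recovered from the frame formula.\<close>
  define X where "X p = Z p p" for p
  have X_frame: "X p c = h p *\<^sub>R cramer_solution E p"
    if E: "local_frame c N h E" "p \<in> N" for c N h E p
  proof (rule riesz_at[OF E \<xi> sol[OF E]])
    fix W assume W: "W \<in> vector_fields A" "W p c = h p *\<^sub>R cramer_solution E p"
      "\<And>Y. Y \<in> vector_fields A \<Longrightarrow> g W Y p = \<xi> Y p"
    have "Z p p = W p"
      using W Z by (intro vector_field_eq_at) auto
    then show ?thesis using W(2) by (simp add: X_def)
  qed
  have X: "X \<in> vector_fields A"
  proof (rule vector_fieldsI)
    show "X p \<in> tangent_space A p" for p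
      using Z(1)[of p] by (simp add: X_def vector_fields_def)
    fix p
    obtain c where c: "c \<in> A" "p \<in> fst c" by (rule covering)
    then obtain N h E where E: "local_frame c N h E" "p \<in> N" by (rule local_frame_exists)
    have N: "open N" "N \<subseteq> fst c" and E_vf: "E i \<in> vector_fields A" for i
      using E(1) by (auto simp: local_frame_def)
    have op: "open (snd c ` N)" by (rule open_chart_image_subset[OF c(1) N])
    have smooth: "smooth_on (snd c ` N) (\<lambda>y. f (chart_inv c y))" if "f \<in> smooth_functions A" for f
      using that c(1) N(2)
      by (auto simp: smooth_functions_def comp_def intro: smooth_on_subset)
    have h: "smooth_on (snd c ` N) (\<lambda>y. h (chart_inv c y))"
      by (rule smooth[OF local_frame_cutoff_smooth[OF E(1)]])
    have gram: "smooth_on (snd c ` N) (\<lambda>y. gram_matrix E (chart_inv c y) $ i $ j)" for i j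
      using smooth[OF metric_smooth[OF E_vf E_vf]] by (simp add: gram_matrix_def)
    have \<xi>E: "smooth_on (snd c ` N) (\<lambda>y. \<xi> (E i) (chart_inv c y))" for i
      using smooth \<xi> E_vf by (simp add: fun_linear_def)
    have "smooth_on (snd c ` N) (\<lambda>y. h (chart_inv c y) *\<^sub>R cramer_solution E (chart_inv c y))"
      unfolding cramer_solution_def
    proof (intro smooth_on_scaleR smooth_on_vec_lambda smooth_on_divide smooth_on_det op h gram)
      show "smooth_on (snd c ` N) (\<lambda>y. (\<chi> i j. if j = k then (\<chi> i. \<xi> (E i) (chart_inv c y)) $ i
          else gram_matrix E (chart_inv c y) $ i $ j) $ i $ j)" for i j k
        using \<xi>E gram by (cases "j = k") simp_all
      show "det (gram_matrix E (chart_inv c y)) \<noteq> 0" if "y \<in> snd c ` N" for y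
        using det_gram_matrix_nonzero[OF E(1)] that c(1) N(2) by (auto simp: subset_iff)
    qed
    then have "smooth_on (snd c ` N) (\<lambda>y. X (chart_inv c y) c)"
      by (rule smooth_on_cong[OF op, rotated])
        (use X_frame[OF E(1)] c(1) N(2) in \<open>auto simp: subset_iff\<close>)
    then show "\<exists>c\<in>A. \<exists>W. open W \<and> p \<in> W \<and> W \<subseteq> fst c \<and>
        smooth_on (snd c ` W) (\<lambda>y. X (chart_inv c y) c)"
      using c(1) N E(2) by blast
  qed
  moreover have "g X Y = \<xi> Y" if "Y \<in> vector_fields A" for Y
  proof
    fix p
    show "g X Y p = \<xi> Y p"
      using metric_cong_at[OF X Z(1)[of p] that, of p] Z(2)[OF that] by (simp add: X_def)
  qed
  ultimately show ?thesis by (rule that)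
qed

section \<open>The isomorphisms flat and sharp of the metric\<close>

lemma flat_one_forms: "X \<in> vector_fields A \<Longrightarrow> flat A g X \<in> one_forms A"
  unfolding flat_def by (rule one_formsI[OF metric_linear_right])

lemma inj_on_flat: "inj_on (flat A g) (vector_fields A)"
proof (rule inj_onI)
  fix X Y assume XY: "X \<in> vector_fields A" "Y \<in> vector_fields A" "flat A g X = flat A g Y"
  have "g X Z = g Y Z" if "Z \<in> vector_fields A" for Z
    using fun_cong[OF XY(3), of Z] that by (simp add: flat_def)
  then have "X p = Y p" for p
    by (intro vector_field_eq_at XY) simp
  then show "X = Y" by (rule ext)
qed

text \<open>Since \<open>flat A g\<close> is injective on fields, exhibiting one preimage of
  \<open>\<xi>\<close> identifies the value chosen by \<open>inv_into\<close>. The algebraic rules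
  for \<open>sharp A g\<close> are all obtained in this way.\<close>

lemma sharp_eqI:
  assumes "Z \<in> vector_fields A" "\<xi> \<in> one_forms A"
    and "\<And>Y. Y \<in> vector_fields A \<Longrightarrow> g Z Y = \<xi> Y"
  shows "sharp A g \<xi> = Z"
proof -
  have "\<xi> = flat A g Z"
    by (rule one_forms_eqI[OF assms(2) flat_one_forms[OF assms(1)]])
      (use assms(3) in \<open>simp add: flat_def\<close>)
  then show ?thesis
    using inv_into_f_f[OF inj_on_flat assms(1)] by (simp add: sharp_def)
qed

text \<open>Here \<open>riesz\<close> supplies the surjectivity of \<open>flat A g\<close>, so the
  value of \<open>inv_into\<close> is a genuine preimage.\<close>

lemma
  assumes "\<xi> \<in> one_forms A"
  shows sharp_vector_field: "sharp A g \<xi> \<in> vector_fields A"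
    and metric_sharp: "Y \<in> vector_fields A \<Longrightarrow> g (sharp A g \<xi>) Y = \<xi> Y"
proof -
  obtain Z where "Z \<in> vector_fields A" "\<And>Y. Y \<in> vector_fields A \<Longrightarrow> g Z Y = \<xi> Y"
    using riesz[OF one_forms_linear[OF assms]] by blast
  moreover from this have "sharp A g \<xi> = Z" using sharp_eqI assms by blast
  ultimately show "sharp A g \<xi> \<in> vector_fields A"
    and "Y \<in> vector_fields A \<Longrightarrow> g (sharp A g \<xi>) Y = \<xi> Y"
    by auto
qed

lemma sharp_zero: "sharp A g 0 = 0"
  by (rule sharp_eqI[OF vector_fields_zero one_forms_zero]) (simp add: metric_zero_left)

lemma sharp_add:
  "\<xi> \<in> one_forms A \<Longrightarrow> \<eta> \<in> one_forms A \<Longrightarrow> sharp A g (\<xi> + \<eta>) = sharp A g \<xi> + sharp A g \<eta>"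
  by (rule sharp_eqI)
    (simp_all add: vector_fields_add one_forms_add sharp_vector_field metric_add_left metric_sharp)

lemma sharp_scale:
  "f \<in> smooth_functions A \<Longrightarrow> \<xi> \<in> one_forms A \<Longrightarrow>
    sharp A g (form_scale f \<xi>) = vf_scale f (sharp A g \<xi>)"
  by (rule sharp_eqI)
    (simp_all add: vector_fields_scale one_forms_scale sharp_vector_field metric_scale_left
      metric_sharp, simp add: form_scale_def)

lemma sharp_flat: "X \<in> vector_fields A \<Longrightarrow> sharp A g (flat A g X) = X"
  using inv_into_f_f[OF inj_on_flat] by (simp add: sharp_def)

section \<open>The metric induced on the generalized tangent bundle\<close>

lemma induced_metric_bilinear:
  "symmetric_bilinear (smooth_functions A) gscale (gsections A) (induced_metric A g)"
proof -
  have lin: "fun_linear (smooth_functions A) gscale (gsections A) (*) (smooth_functions A)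
      (\<lambda>v. induced_metric A g v u)" if "u \<in> gsections A" for u
    using that
    by (auto simp: fun_linear_def gsections_def gscale_def induced_metric_def smooth_functions_add
        metric_smooth sharp_vector_field metric_add_left metric_scale_left sharp_add sharp_scale
        algebra_simps)
  moreover have comm: "induced_metric A g u v = induced_metric A g v u"
    if "u \<in> gsections A" "v \<in> gsections A" for u v
    using that by (auto simp: gsections_def induced_metric_def metric_commute sharp_vector_field)
  moreover have "fun_linear (smooth_functions A) gscale (gsections A) (*) (smooth_functions A)
      (induced_metric A g u)" if u: "u \<in> gsections A" for u
  proof -
    have "v + w \<in> gsections A" "f \<in> smooth_functions A \<Longrightarrow> gscale f v \<in> gsections A"
      if "v \<in> gsections A" "w \<in> gsections A" for v w f
      using that by (auto simp: gsections_def gscale_def vector_fields_add vector_fields_scale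
          one_forms_add one_forms_scale)
    then show ?thesis
      using lin[OF u] comm[OF u] by (simp add: fun_linear_def)
  qed
  ultimately show ?thesis by (simp add: symmetric_bilinear_def)
qed

lemma induced_metric_nondegenerate:
  "Defs.nondegenerate (gsections A) (gvanishes A) (induced_metric A g)"
  unfolding nondegenerate_def
proof (intro allI ballI impI)
  fix p u assume "u \<in> gsections A" and *: "\<forall>v\<in>gsections A. induced_metric A g u v p = 0"
  then obtain X \<xi> where u: "u = (X, \<xi>)" "X \<in> vector_fields A" "\<xi> \<in> one_forms A"
    by (auto simp: gsections_def)
  have zero: "g Z 0 = 0" if "Z \<in> vector_fields A" for Z
    using function_linear_zero[OF metric_linear_right[OF that]] .
  have "g X Y p = 0" if "Y \<in> vector_fields A" for Y
    using bspec[OF *, of "(Y, 0)"] that u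
    by (simp add: gsections_def induced_metric_def one_forms_zero sharp_zero zero sharp_vector_field)
  then have "X p = 0"
    using nondegenerate u(2) unfolding nondegenerate_def vf_vanishes_def by blast
  moreover have "\<xi> Y p = 0" if "Y \<in> vector_fields A" for Y
    \<comment> \<open>Pairing with the form \<open>flat A g Y\<close> evaluates \<open>\<xi>\<close>
      on \<open>Y\<close>, because \<open>sharp A g\<close> takes that form back to
      \<open>Y\<close>.\<close>
    using bspec[OF *, of "(0, flat A g Y)"] that u
    by (simp add: gsections_def induced_metric_def flat_one_forms sharp_flat zero vector_fields_zero
        metric_sharp)
  ultimately show "gvanishes A u p"
    using u(1) by (simp add: gvanishes_def vf_vanishes_def)
qed

text \<open>Both directions are used: one for Riemannian metrics, the other to carry the failure of
  positive definiteness over in the pseudo-Riemannian case. For the less direct one, if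
  \<open>sharp A g \<xi>\<close> vanishes at p then so does every \<open>\<xi> Y\<close>, by
  locality; hence a nonvanishing section has a nonzero field part or a nonzero sharpened form part
  at p.\<close>

lemma induced_metric_positive_definite_iff:
  "positive_definite (gsections A) (gvanishes A) (induced_metric A g) \<longleftrightarrow>
    positive_definite (vector_fields A) vf_vanishes g"
proof
  assume pos: "positive_definite (gsections A) (gvanishes A) (induced_metric A g)"
  show "positive_definite (vector_fields A) vf_vanishes g"
    unfolding positive_definite_def
  proof (intro allI ballI impI)
    fix p X assume X: "X \<in> vector_fields A" "\<not> vf_vanishes X p"
    then have "(X, 0) \<in> gsections A" "\<not> gvanishes A (X, 0) p"
      by (auto simp: gsections_def gvanishes_def one_forms_zero)
    then have "induced_metric A g (X, 0) (X, 0) p > 0"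
      using pos unfolding positive_definite_def by blast
    then show "g X X p > 0"
      by (simp add: induced_metric_def sharp_zero metric_zero_left vector_fields_zero)
  qed
next
  assume pos: "positive_definite (vector_fields A) vf_vanishes g"
  have g_pos: "g X X p > 0" if "X \<in> vector_fields A" "X p \<noteq> 0" for X p
    using pos that by (auto simp: positive_definite_def vf_vanishes_def)
  have g_zero: "g X Y p = 0" if "X \<in> vector_fields A" "Y \<in> vector_fields A" "X p = 0" for X Y p
    using function_linear_local[OF metric_linear_left] that by blast
  have g_nonneg: "g X X p \<ge> 0" if "X \<in> vector_fields A" for X p
    using g_pos[OF that, of p] g_zero[OF that that, of p] by (cases "X p = 0") auto
  show "positive_definite (gsections A) (gvanishes A) (induced_metric A g)"
    unfolding positive_definite_def
  proof (intro allI ballI impI)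
    fix p u assume "u \<in> gsections A" and nz: "\<not> gvanishes A u p"
    then obtain X \<xi> where u: "u = (X, \<xi>)" "X \<in> vector_fields A" "\<xi> \<in> one_forms A"
      by (auto simp: gsections_def)
    note Z = sharp_vector_field[OF u(3)]
    have "X p \<noteq> 0 \<or> sharp A g \<xi> p \<noteq> 0"
    proof (rule ccontr)
      assume "\<not> ?thesis"
      then have "X p = 0" "\<xi> Y p = 0" if "Y \<in> vector_fields A" for Y
        using g_zero[OF Z that] metric_sharp[OF u(3) that] by auto
      then show False
        using nz u(1) vector_fields_zero by (auto simp: gvanishes_def vf_vanishes_def)
    qed
    then have "g X X p + g (sharp A g \<xi>) (sharp A g \<xi>) p > 0"
      using g_pos[OF u(2), of p] g_pos[OF Z, of p] g_nonneg[OF u(2), of p] g_nonneg[OF Z, of p]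
      by auto
    then show "induced_metric A g u u p > 0"
      by (simp add: induced_metric_def u(1))
  qed
qed

end

section \<open>The diagonal structure lifted from F\<close>

locale metric_product_structure = metric_on_manifold A g
  for A :: "('a::{t2_space,second_countable_topology}, 'n::finite) chart set" and g +
  fixes F :: "('a, 'n) vfield \<Rightarrow> ('a, 'n) vfield" and \<epsilon> :: real
  assumes F_linear:
      "fun_linear (smooth_functions A) vf_scale (vector_fields A) vf_scale (vector_fields A) F"
    and F_F: "X \<in> vector_fields A \<Longrightarrow> F (F X) = X"
    and metric_F_F:
      "X \<in> vector_fields A \<Longrightarrow> Y \<in> vector_fields A \<Longrightarrow> g (F X) (F Y) p = \<epsilon> * g X Y p"
    and \<epsilon>: "\<epsilon> \<in> {1, -1}"
begin

lemma F_vector_field: "X \<in> vector_fields A \<Longrightarrow> F X \<in> vector_fields A"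
  and F_add: "X \<in> vector_fields A \<Longrightarrow> Y \<in> vector_fields A \<Longrightarrow> F (X + Y) = F X + F Y"
  and F_scale:
    "f \<in> smooth_functions A \<Longrightarrow> X \<in> vector_fields A \<Longrightarrow> F (vf_scale f X) = vf_scale f (F X)"
  using F_linear by (auto simp: fun_linear_def)

text \<open>Apply the compatibility of g and F to \<open>F X\<close> in place of \<open>X\<close>
  and cancel \<open>F (F X)\<close>.\<close>

lemma metric_F_right:
  assumes "X \<in> vector_fields A" "Y \<in> vector_fields A"
  shows "g X (F Y) p = \<epsilon> * g (F X) Y p"
  using metric_F_F[OF F_vector_field[OF assms(1)] assms(2)] F_F[OF assms(1)] by simp

lemma sharp_dual_map:
  assumes "\<xi> \<in> one_forms A"
  shows "sharp A g (dual_map A F \<xi>) = vf_scale (\<lambda>_. \<epsilon>) (F (sharp A g \<xi>))"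
proof (rule sharp_eqI)
  note Z = sharp_vector_field[OF assms]
  show "vf_scale (\<lambda>_. \<epsilon>) (F (sharp A g \<xi>)) \<in> vector_fields A"
    by (intro vector_fields_scale smooth_functions_const F_vector_field Z)
  show "dual_map A F \<xi> \<in> one_forms A"
    by (rule dual_map_one_forms[OF F_linear assms])
  show "g (vf_scale (\<lambda>_. \<epsilon>) (F (sharp A g \<xi>))) Y = dual_map A F \<xi> Y"
    if Y: "Y \<in> vector_fields A" for Y
  proof
    fix p
    have "\<xi> (F Y) p = g (sharp A g \<xi>) (F Y) p"
      using metric_sharp[OF assms F_vector_field[OF Y]] by simp
    then show "g (vf_scale (\<lambda>_. \<epsilon>) (F (sharp A g \<xi>))) Y p = dual_map A F \<xi> Y p"
      using Y Z by (simp add: dual_map_def metric_scale_left smooth_functions_const F_vector_field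
          metric_F_right)
  qed
qed

text \<open>For \<epsilon> = -1 the tensor \<phi> is skew, so it is not an instance of the metric
  locale and \<open>sharp_eqI\<close> does not apply to it. Injectivity of its \<open>flat\<close>
  comes instead from that of \<open>flat A g\<close> and of the involution F.\<close>

lemma sharp_fundamental_tensor:
  assumes "\<xi> \<in> one_forms A"
  shows "sharp A (fundamental_tensor g F) \<xi> = F (sharp A g \<xi>)"
proof -
  note Z = sharp_vector_field[OF assms]
  have flat: "flat A (fundamental_tensor g F) X = flat A g (F X)" for X
    by (simp add: flat_def fundamental_tensor_def fun_eq_iff)
  have inj: "inj_on (flat A (fundamental_tensor g F)) (vector_fields A)"
  proof (rule inj_onI)
    fix X Y assume XY: "X \<in> vector_fields A" "Y \<in> vector_fields A"
      "flat A (fundamental_tensor g F) X = flat A (fundamental_tensor g F) Y"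
    then have "F X = F Y"
      using inj_on_flat F_vector_field by (auto simp: flat inj_on_def)
    then show "X = Y" using F_F XY(1,2) by metis
  qed
  have eq: "\<xi> = flat A (fundamental_tensor g F) (F (sharp A g \<xi>))"
    unfolding flat F_F[OF Z]
    by (rule one_forms_eqI[OF assms flat_one_forms[OF Z]])
      (simp add: flat_def metric_sharp[OF assms])
  show ?thesis
    using inv_into_f_f[OF inj F_vector_field[OF Z]]
    unfolding eq[symmetric] sharp_def[of A "fundamental_tensor g F"] .
qed

lemma diag_structure_Pair:
  "diag_structure A l F (X, \<xi>) = (F X, form_scale (\<lambda>_. l) (dual_map A F \<xi>))"
  by (simp add: diag_structure_def block_matrix_def)

lemma sharp_diag_structure:
  assumes "\<xi> \<in> one_forms A"
  shows "sharp A g (form_scale (\<lambda>_. l) (dual_map A F \<xi>)) =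
    vf_scale (\<lambda>_. l * \<epsilon>) (F (sharp A g \<xi>))"
  using sharp_scale[OF smooth_functions_const dual_map_one_forms[OF F_linear assms]]
  by (simp add: sharp_dual_map[OF assms] vf_scale_def)

lemma diag_structure_almost_product:
  assumes "l \<in> {1, -1}"
  shows "gen_almost_product A (diag_structure A l F)"
  unfolding gen_almost_product_def
proof (intro conjI ballI)
  have dual_add: "dual_map A F (\<xi> + \<eta>) = dual_map A F \<xi> + dual_map A F \<eta>" for \<xi> \<eta>
    by (simp add: dual_map_def fun_eq_iff)
  have dual_scale: "dual_map A F (form_scale f \<xi>) = form_scale f (dual_map A F \<xi>)" for f \<xi>
    by (simp add: dual_map_def form_scale_def fun_eq_iff)
  have scale_add: "form_scale f (\<xi> + \<eta>) = form_scale f \<xi> + form_scale f \<eta>"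
    for f and \<xi> \<eta> :: "('a, 'n) oneform"
    by (simp add: form_scale_def fun_eq_iff algebra_simps)
  have scale_scale: "form_scale f (form_scale k \<xi>) = form_scale k (form_scale f \<xi>)"
    for f k and \<xi> :: "('a, 'n) oneform"
    by (simp add: form_scale_def fun_eq_iff algebra_simps)
  show "fun_linear (smooth_functions A) gscale (gsections A) gscale (gsections A)
      (diag_structure A l F)"
    unfolding fun_linear_def gsections_def
    by (auto simp: diag_structure_Pair gscale_def F_vector_field F_add F_scale dual_add dual_scale
        scale_add scale_scale one_forms_scale smooth_functions_const dual_map_one_forms[OF F_linear])
  fix u assume "u \<in> gsections A"
  then obtain X \<xi> where u: "u = (X, \<xi>)" "X \<in> vector_fields A" "\<xi> \<in> one_forms A"
    by (auto simp: gsections_def)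
  have "form_scale (\<lambda>_. l) (form_scale (\<lambda>_. l) (dual_map A F (dual_map A F \<xi>))) = \<xi>"
  proof
    fix Y
    show "form_scale (\<lambda>_. l) (form_scale (\<lambda>_. l) (dual_map A F (dual_map A F \<xi>))) Y = \<xi> Y"
      using assms u(3)
      \<comment> \<open>On fields the two factors l and the two factors F cancel; off
        \<open>vector_fields A\<close> both sides are the default value 0 of a 1-form.\<close>
      by (cases "Y \<in> vector_fields A")
        (auto simp: form_scale_def dual_map_def F_vector_field F_F one_forms_outside fun_eq_iff)
  qed
  then show "diag_structure A l F (diag_structure A l F u) = u"
    using u by (simp add: diag_structure_Pair F_F dual_scale)
qed

text \<open>The field part scales by \<epsilon> directly. On the form part \<open>sharp A g\<close>
  turns the lifted map into l \<epsilon> F, giving the factor \<epsilon> times the square of l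
  \<epsilon>, which is again \<epsilon>; the two blocks agree on the sign for either l.\<close>

lemma diag_structure_compatible:
  assumes "l \<in> {1, -1}"
  shows "compatible_with_sign A \<epsilon> (diag_structure A l F) (induced_metric A g)"
  unfolding compatible_with_sign_def
proof (intro ballI allI)
  fix u v p assume "u \<in> gsections A" "v \<in> gsections A"
  then obtain X \<xi> Y \<eta> where uv: "u = (X, \<xi>)" "v = (Y, \<eta>)" "X \<in> vector_fields A"
    "\<xi> \<in> one_forms A" "Y \<in> vector_fields A" "\<eta> \<in> one_forms A"
    by (auto simp: gsections_def)
  have "l * \<epsilon> * (l * \<epsilon>) = 1" using assms \<epsilon> by auto
  then show "induced_metric A g (diag_structure A l F u) (diag_structure A l F v) p =
      \<epsilon> * induced_metric A g u v p"
    using uv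
    by (simp add: induced_metric_def diag_structure_Pair sharp_diag_structure metric_scale_left
        metric_scale_right smooth_functions_const vector_fields_scale F_vector_field
        sharp_vector_field metric_F_F algebra_simps)
qed

lemma fundamental_tensor_diag_structure:
  assumes "X \<in> vector_fields A" "Y \<in> vector_fields A" "\<xi> \<in> one_forms A" "\<eta> \<in> one_forms A"
  shows "fundamental_tensor (induced_metric A g) (diag_structure A l F) (X, \<xi>) (Y, \<eta>) p =
    fundamental_tensor g F X Y p + l * fundamental_tensor g F
      (sharp A (fundamental_tensor g F) \<xi>) (sharp A (fundamental_tensor g F) \<eta>) p"
proof -
  note Z = sharp_vector_field[OF assms(3)] and W = sharp_vector_field[OF assms(4)]
  have "g (sharp A g (form_scale (\<lambda>_. l) (dual_map A F \<xi>))) (sharp A g \<eta>) p =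
      l * (\<epsilon> * g (F (sharp A g \<xi>)) (sharp A g \<eta>) p)"
    unfolding sharp_diag_structure[OF assms(3)]
    by (simp add: metric_scale_left smooth_functions_const F_vector_field Z W)
  \<comment> \<open>The remaining \<epsilon> is absorbed by applying F to both arguments.
    \<open>F (sharp A g \<xi>)\<close> and \<open>F (sharp A g \<eta>)\<close> are the
    \<phi>-sharps, and the outer F in the first argument is the one in \<phi>.\<close>
  also have "\<dots> = l * g (F (F (sharp A g \<xi>))) (F (sharp A g \<eta>)) p"
    by (simp add: metric_F_F F_vector_field Z W)
  finally show ?thesis
    by (simp add: fundamental_tensor_def[where b = "induced_metric A g"] diag_structure_Pair
        induced_metric_def sharp_fundamental_tensor[OF assms(3)]
        sharp_fundamental_tensor[OF assms(4)])
      (simp add: fundamental_tensor_def)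
qed

end

lemma riemannian_imp_nondegenerate:
  assumes "riemannian_metric A g"
  shows "nondegenerate (vector_fields A) vf_vanishes g"
  using assms unfolding riemannian_metric_def positive_definite_def nondegenerate_def
  by (metis less_irrefl)

theorem proposition4p18:
  fixes A :: "('a::{t2_space,second_countable_topology}, 'n::finite) chart set"
    and F :: "('a, 'n) vfield \<Rightarrow> ('a, 'n) vfield"
    and g \<phi> :: "('a, 'n) vf_form"
    and \<epsilon> l :: real
  assumes "metric_manifold 1 \<epsilon> A F g"
    and "l \<in> {1, -1}"
  defines "\<phi> \<equiv> fundamental_tensor g F"
  shows "gen_almost_product A (diag_structure A l F) \<and>
    compatible A (diag_structure A l F) (induced_metric A g) \<and>
    (\<epsilon> = 1 \<longrightarrow>
       (riemannian_metric A g \<longrightarrow>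
          gen_riemannian_almost_product A (diag_structure A l F) (induced_metric A g)) \<and>
       (pseudo_riemannian_metric A g \<longrightarrow>
          gen_pseudo_riemannian_almost_product A (diag_structure A l F) (induced_metric A g))) \<and>
    (\<epsilon> = -1 \<longrightarrow>
       gen_almost_para_hermitian A (diag_structure A l F) (induced_metric A g)) \<and>
    (\<forall>X\<in>vector_fields A. \<forall>Y\<in>vector_fields A. \<forall>\<xi>\<in>one_forms A. \<forall>\<eta>\<in>one_forms A. \<forall>p.
       fundamental_tensor (induced_metric A g) (diag_structure A l F) (X, \<xi>) (Y, \<eta>) p =
         \<phi> X Y p + l * \<phi> (sharp A \<phi> \<xi>) (sharp A \<phi> \<eta>) p)"
proof -
  have metric: "riemannian_metric A g \<or> pseudo_riemannian_metric A g"
    using assms(1) by (simp add: metric_manifold_def)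
  interpret metric_product_structure A g F \<epsilon>
  proof
    show "symmetric_bilinear (smooth_functions A) vf_scale (vector_fields A) g"
      using metric by (auto simp: riemannian_metric_def pseudo_riemannian_metric_def)
    show "Defs.nondegenerate (vector_fields A) vf_vanishes g"
      using metric riemannian_imp_nondegenerate by (auto simp: pseudo_riemannian_metric_def)
  qed (use assms(1) in \<open>auto simp: metric_manifold_def vf_scale_def\<close>)
  have riemannian: "gen_riemannian_metric A (induced_metric A g)" if "riemannian_metric A g"
    using that induced_metric_bilinear induced_metric_positive_definite_iff
    by (simp add: gen_riemannian_metric_def riemannian_metric_def)
  have pseudo: "gen_pseudo_riemannian_metric A (induced_metric A g)"
    if "pseudo_riemannian_metric A g"
    using that induced_metric_bilinear induced_metric_nondegenerate
      induced_metric_positive_definite_iff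
    by (simp add: gen_pseudo_riemannian_metric_def pseudo_riemannian_metric_def)
  note product = diag_structure_almost_product[OF assms(2)]
  note compat = diag_structure_compatible[OF assms(2)]
  show ?thesis
  proof (intro conjI impI ballI allI)
    \<comment> \<open>The sign \<delta> required for compatibility is \<epsilon> itself.\<close>
    show "compatible A (diag_structure A l F) (induced_metric A g)"
      using compat \<epsilon> unfolding compatible_def by blast
    show "gen_riemannian_almost_product A (diag_structure A l F) (induced_metric A g)"
      if "\<epsilon> = 1" "riemannian_metric A g"
      using that product compat riemannian by (simp add: gen_riemannian_almost_product_def)
    show "gen_pseudo_riemannian_almost_product A (diag_structure A l F) (induced_metric A g)"
      if "\<epsilon> = 1" "pseudo_riemannian_metric A g"
      using that product compat pseudo by (simp add: gen_pseudo_riemannian_almost_product_def)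
    show "gen_almost_para_hermitian A (diag_structure A l F) (induced_metric A g)" if "\<epsilon> = -1"
      using that product compat riemannian pseudo metric
      by (auto simp: gen_almost_para_hermitian_def)
  qed (use product fundamental_tensor_diag_structure in \<open>auto simp: \<phi>_def\<close>)
qed

end
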